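(* Let $K$ be an algebraically closed field of characteristic zero. Every quadruple $(A,M,\omega,\zeta)$, where $A$ is a finite-dimensional semisimple associative $K$-algebra, $M$ is a finite-dimensional $A$-$A$-bimodule, $\omega$ is a balanced symplectic bilinear form on $M$, and $\zeta:A\to K$ is a linear map with $\zeta(ab)=\zeta(ba)$ for all $a,b\in A$, is equivalent to $(\mathrm{End}(\alpha),\mathrm{Rep}(\overline{Q},\alpha),\omega_\alpha,\zeta_\lambda)$ for some quiver $Q$ with vertex set $I$, some $\alpha\in\mathbb{N}^I$ and some $\lambda\in K^I$.
   Context: A symplectic form is a non-degenerate alternating bilinear form; $\omega$ is balanced if $\omega(x,ay)=\omega(xa,y)$ for all $a\in A$, $x,y\in M$. For a finite quiver $Q$ with vertex set $I$, $h(a)$ and $t(a)$ denote the head and tail of an arrow $a$; $\overline{Q}$ is the double of $Q$, obtained by adjoining a reverse arrow $a^*$ for each $a\in Q$. For $\alpha\in\mathbb{N}^I$, $\mathrm{End}(\alpha)=\prod_{i\in I}\mathrm{Mat}(\alpha_i,K)$ and $\mathrm{Rep}(\overline{Q},\alpha)=\bigoplus_{a\in\overline{Q}}\mathrm{Mat}(\alpha_{h(a)}\times\alpha_{t(a)},K)$, an $\mathrm{End}(\alpha)$-$\mathrm{End}(\alpha)$-bimodule via $(\theta x)_a=\theta_{h(a)}x_a$, $(x\theta)_a=x_a\theta_{t(a)}$. Further $\omega_\alpha(x,y)=\sum_{a\in Q}(\mathrm{tr}(x_{a^*}y_a)-\mathrm{tr}(x_ay_{a^*}))$ and, for $\lambda\in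 K^I$, $\zeta_\lambda(\theta)=\sum_{i\in I}\lambda_i\,\mathrm{tr}(\theta_i)$. Two quadruples $(A,M,\omega,\zeta)$ and $(A',M',\omega',\zeta')$ are equivalent if there is an algebra isomorphism $f:A\to A'$ with $\zeta'(f(a))=\zeta(a)$ for all $a\in A$, and an $A$-$A$-bimodule isomorphism $g:M\to{}_fM'_f$ (where ${}_fM'_f$ is $M'$ with $A$ acting on both sides through $f$) with $\omega'(g(m_1),g(m_2))=\omega(m_1,m_2)$ for all $m_1,m_2\in M$. *)

theory Defs
  imports
    "HOL-Computational_Algebra.Polynomial"
    "HOL-Library.FuncSet"
    "HOL-Algebra.QuotRing"
    "Jordan_Normal_Form.Matrix"
    "Graph_Theory.Digraph"
begin

section \<open>Algebras, bimodules and forms\<close>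

text \<open>
  The sort \<open>{ring, monoid_mult}\<close> describes associative unital rings in which \<open>0 = 1\<close> is not
  excluded, so that the zero algebra is covered.
\<close>

locale k_algebra = vector_space scale
  for scale :: "'k::field \<Rightarrow> 'a::{ring, monoid_mult} \<Rightarrow> 'a" +
  assumes scale_mult_left: "scale c (a * b) = scale c a * b"
    and scale_mult_right: "scale c (a * b) = a * scale c b"

definition left_ideal :: "'a::ring set \<Rightarrow> bool" where
  "left_ideal L \<longleftrightarrow>
     0 \<in> L \<and> (\<forall>x\<in>L. \<forall>y\<in>L. x + y \<in> L) \<and> (\<forall>a. \<forall>x\<in>L. a * x \<in> L)"

text \<open>
  Semisimplicity of the left regular module: every submodule is a direct summand. Left ideals of a
  unital algebra are automatically closed under negation and under scalars.
\<close>

definition semisimple_ring :: "'a::{ring, monoid_mult} itself \<Rightarrow> bool" where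
  "semisimple_ring _ \<longleftrightarrow>
     (\<forall>L :: 'a set. left_ideal L \<longrightarrow>
        (\<exists>L'. left_ideal L' \<and> L \<inter> L' = {0} \<and> {x + y | x y. x \<in> L \<and> y \<in> L'} = UNIV))"

text \<open>Both actions restrict to the same scalar multiplication by \<open>K\<close>.\<close>

locale k_bimodule = alg: k_algebra scaleA + vs: vector_space scaleM
  for scaleA :: "'k::field \<Rightarrow> 'a::{ring, monoid_mult} \<Rightarrow> 'a"
    and scaleM :: "'k \<Rightarrow> 'm::ab_group_add \<Rightarrow> 'm" +
  fixes l :: "'a \<Rightarrow> 'm \<Rightarrow> 'm" and r :: "'m \<Rightarrow> 'a \<Rightarrow> 'm"
  assumes l_add: "l a (x + y) = l a x + l a y"
    and l_add_alg: "l (a + b) x = l a x + l b x"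
    and l_mult: "l (a * b) x = l a (l b x)"
    and l_one: "l 1 x = x"
    and r_add: "r (x + y) a = r x a + r y a"
    and r_add_alg: "r x (a + b) = r x a + r x b"
    and r_mult: "r x (a * b) = r (r x a) b"
    and r_one: "r x 1 = x"
    and l_r_assoc: "r (l a x) b = l a (r x b)"
    and l_scale: "l a (scaleM c x) = scaleM c (l a x)"
    and l_scale_alg: "l (scaleA c a) x = scaleM c (l a x)"
    and r_scale: "r (scaleM c x) a = scaleM c (r x a)"
    and r_scale_alg: "r x (scaleA c a) = scaleM c (r x a)"

definition bilinear_form :: "('k::field \<Rightarrow> 'm::ab_group_add \<Rightarrow> 'm) \<Rightarrow> ('m \<Rightarrow> 'm \<Rightarrow> 'k) \<Rightarrow> bool" where
  "bilinear_form scaleM \<omega> \<longleftrightarrow>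
     (\<forall>x. Vector_Spaces.linear scaleM (*) (\<lambda>y. \<omega> x y)) \<and>
     (\<forall>y. Vector_Spaces.linear scaleM (*) (\<lambda>x. \<omega> x y))"

definition symplectic_form :: "('k::field \<Rightarrow> 'm::ab_group_add \<Rightarrow> 'm) \<Rightarrow> ('m \<Rightarrow> 'm \<Rightarrow> 'k) \<Rightarrow> bool" where
  "symplectic_form scaleM \<omega> \<longleftrightarrow>
     bilinear_form scaleM \<omega> \<and> (\<forall>x. \<omega> x x = 0) \<and> (\<forall>x. (\<forall>y. \<omega> x y = 0) \<longrightarrow> x = 0)"

definition balanced :: "('a \<Rightarrow> 'm \<Rightarrow> 'm) \<Rightarrow> ('m \<Rightarrow> 'a \<Rightarrow> 'm) \<Rightarrow> ('m \<Rightarrow> 'm \<Rightarrow> 'k) \<Rightarrow> bool" where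
  "balanced l r \<omega> \<longleftrightarrow> (\<forall>a x y. \<omega> x (l a y) = \<omega> (r x a) y)"


section \<open>Equivalence of quadruples\<close>

text \<open>
  \<open>End(\<alpha>)\<close> and \<open>Rep\<close> depend on data that is existentially quantified, so they are not types.
  Equivalence is therefore formulated for structures with explicit carriers, an algebra being a
  \<open>module\<close> record with all of its ring fields in use. In a bimodule record the fields \<open>mult\<close> and
  \<open>one\<close> carry no meaning, as usual for modules in HOL-Algebra.
\<close>

record ('k, 'a, 'm) bimodule = "('k, 'm) module" +
  lact :: "'a \<Rightarrow> 'm \<Rightarrow> 'm"
  ract :: "'m \<Rightarrow> 'a \<Rightarrow> 'm"

definition type_algebra :: "('k \<Rightarrow> 'a::{ring, monoid_mult} \<Rightarrow> 'a) \<Rightarrow> ('k, 'a) module" where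
  "type_algebra scaleA =
     \<lparr>carrier = UNIV, mult = (*), one = 1, zero = 0, add = (+), smult = scaleA\<rparr>"

definition type_bimodule ::
  "('k \<Rightarrow> 'm::ab_group_add \<Rightarrow> 'm) \<Rightarrow> ('a \<Rightarrow> 'm \<Rightarrow> 'm) \<Rightarrow> ('m \<Rightarrow> 'a \<Rightarrow> 'm) \<Rightarrow> ('k, 'a, 'm) bimodule"
  where
  "type_bimodule scaleM l r =
     \<lparr>carrier = UNIV, mult = undefined, one = undefined, zero = 0, add = (+), smult = scaleM,
      lact = l, ract = r\<rparr>"

definition algebra_iso :: "('k, 'a) module \<Rightarrow> ('k, 'b) module \<Rightarrow> ('a \<Rightarrow> 'b) set" where
  "algebra_iso A B =
     {f \<in> ring_iso A B. \<forall>c. \<forall>a\<in>carrier A. f (c \<odot>\<^bsub>A\<^esub> a) = c \<odot>\<^bsub>B\<^esub> f a}"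

definition bimodule_iso ::
  "('k, 'a) module \<Rightarrow> ('k, 'a, 'm) bimodule \<Rightarrow> ('k, 'a, 'n) bimodule \<Rightarrow> ('m \<Rightarrow> 'n) set" where
  "bimodule_iso A M N =
     {g. bij_betw g (carrier M) (carrier N) \<and>
         (\<forall>x\<in>carrier M. \<forall>y\<in>carrier M. g (x \<oplus>\<^bsub>M\<^esub> y) = g x \<oplus>\<^bsub>N\<^esub> g y) \<and>
         (\<forall>c. \<forall>x\<in>carrier M. g (c \<odot>\<^bsub>M\<^esub> x) = c \<odot>\<^bsub>N\<^esub> g x) \<and>
         (\<forall>a\<in>carrier A. \<forall>x\<in>carrier M. g (lact M a x) = lact N a (g x)) \<and>
         (\<forall>a\<in>carrier A. \<forall>x\<in>carrier M. g (ract M x a) = ract N (g x) a)}"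

text \<open>The bimodule \<open>\<^sub>fM\<^sub>f\<close>.\<close>

definition twist :: "('a \<Rightarrow> 'b) \<Rightarrow> ('k, 'b, 'm) bimodule \<Rightarrow> ('k, 'a, 'm) bimodule" where
  "twist f M =
     \<lparr>carrier = carrier M, mult = mult M, one = one M, zero = zero M, add = add M, smult = smult M,
      lact = (\<lambda>a. lact M (f a)), ract = (\<lambda>x a. ract M x (f a))\<rparr>"

definition equivalent ::
  "('k, 'a) module \<times> ('k, 'a, 'm) bimodule \<times> ('m \<Rightarrow> 'm \<Rightarrow> 'k) \<times> ('a \<Rightarrow> 'k) \<Rightarrow>
   ('k, 'b) module \<times> ('k, 'b, 'n) bimodule \<times> ('n \<Rightarrow> 'n \<Rightarrow> 'k) \<times> ('b \<Rightarrow> 'k) \<Rightarrow> bool" where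
  "equivalent = (\<lambda>(A, M, \<omega>, \<zeta>) (A', M', \<omega>', \<zeta>').
     \<exists>f \<in> algebra_iso A A'. \<exists>g \<in> bimodule_iso A M (twist f M').
       (\<forall>a\<in>carrier A. \<zeta>' (f a) = \<zeta> a) \<and>
       (\<forall>x\<in>carrier M. \<forall>y\<in>carrier M. \<omega>' (g x) (g y) = \<omega> x y))"


section \<open>The quadruple of a quiver\<close>

text \<open>
  A finite quiver is a \<open>fin_digraph\<close>: loops and multiple arcs are allowed. In the double, \<open>Inl a\<close>
  is the original arrow \<open>a\<close> and \<open>Inr a\<close> is its reverse \<open>a\<^sup>*\<close>.
\<close>

definition double :: "('v, 'e) pre_digraph \<Rightarrow> ('v, 'e + 'e) pre_digraph" where
  "double Q =
     \<lparr>verts = verts Q, arcs = arcs Q <+> arcs Q,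
      tail = case_sum (tail Q) (head Q), head = case_sum (head Q) (tail Q)\<rparr>"

definition mat_trace :: "'k::comm_monoid_add mat \<Rightarrow> 'k" where
  "mat_trace A = sum_list (diag_mat A)"

definition End_alg :: "'v set \<Rightarrow> ('v \<Rightarrow> nat) \<Rightarrow> ('k::field, 'v \<Rightarrow> 'k mat) module" where
  "End_alg I \<alpha> =
     \<lparr>carrier = (\<Pi>\<^sub>E i\<in>I. carrier_mat (\<alpha> i) (\<alpha> i)),
      mult = (\<lambda>\<theta> \<eta>. \<lambda>i\<in>I. \<theta> i * \<eta> i),
      one = (\<lambda>i\<in>I. 1\<^sub>m (\<alpha> i)),
      zero = (\<lambda>i\<in>I. 0\<^sub>m (\<alpha> i) (\<alpha> i)),
      add = (\<lambda>\<theta> \<eta>. \<lambda>i\<in>I. \<theta> i + \<eta> i),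
      smult = (\<lambda>c \<theta>. \<lambda>i\<in>I. c \<cdot>\<^sub>m \<theta> i)\<rparr>"

text \<open>To be applied to the double of a quiver.\<close>

definition Rep_bimod ::
  "('v, 'e) pre_digraph \<Rightarrow> ('v \<Rightarrow> nat) \<Rightarrow> ('k::field, 'v \<Rightarrow> 'k mat, 'e \<Rightarrow> 'k mat) bimodule" where
  "Rep_bimod G \<alpha> =
     \<lparr>carrier = (\<Pi>\<^sub>E a\<in>arcs G. carrier_mat (\<alpha> (head G a)) (\<alpha> (tail G a))),
      mult = undefined, one = undefined,
      zero = (\<lambda>a\<in>arcs G. 0\<^sub>m (\<alpha> (head G a)) (\<alpha> (tail G a))),
      add = (\<lambda>x y. \<lambda>a\<in>arcs G. x a + y a),
      smult = (\<lambda>c x. \<lambda>a\<in>arcs G. c \<cdot>\<^sub>m x a),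
      lact = (\<lambda>\<theta> x. \<lambda>a\<in>arcs G. \<theta> (head G a) * x a),
      ract = (\<lambda>x \<theta>. \<lambda>a\<in>arcs G. x a * \<theta> (tail G a))\<rparr>"

definition quiver_form ::
  "('v, 'e) pre_digraph \<Rightarrow> ('e + 'e \<Rightarrow> 'k::field mat) \<Rightarrow> ('e + 'e \<Rightarrow> 'k mat) \<Rightarrow> 'k" where
  "quiver_form Q x y =
     (\<Sum>a\<in>arcs Q. mat_trace (x (Inr a) * y (Inl a)) - mat_trace (x (Inl a) * y (Inr a)))"

definition quiver_trace :: "'v set \<Rightarrow> ('v \<Rightarrow> 'k::field) \<Rightarrow> ('v \<Rightarrow> 'k mat) \<Rightarrow> 'k" where
  "quiver_trace I lam \<theta> = (\<Sum>i\<in>I. lam i * mat_trace (\<theta> i))"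

definition quiver_quadruple ::
  "('v, 'e) pre_digraph \<Rightarrow> ('v \<Rightarrow> nat) \<Rightarrow> ('v \<Rightarrow> 'k::field) \<Rightarrow>
   ('k, 'v \<Rightarrow> 'k mat) module \<times> ('k, 'v \<Rightarrow> 'k mat, 'e + 'e \<Rightarrow> 'k mat) bimodule \<times>
   (('e + 'e \<Rightarrow> 'k mat) \<Rightarrow> ('e + 'e \<Rightarrow> 'k mat) \<Rightarrow> 'k) \<times> (('v \<Rightarrow> 'k mat) \<Rightarrow> 'k)" where
  "quiver_quadruple Q \<alpha> lam =
     (End_alg (verts Q) \<alpha>, Rep_bimod (double Q) \<alpha>, quiver_form Q, quiver_trace (verts Q) lam)"

end

theory Submission
  imports Defs
begin

text \<open>
  Write \<open>K\<close> for the ground field. The argument has three steps: coordinates on \<open>A\<close>, coordinates on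
  \<open>M\<close>, and a choice of the latter that is adapted to \<open>\<omega>\<close>.

  The algebra. A semisimple ring is von Neumann regular, and over an algebraically closed field every
  element of a finite-dimensional corner \<open>fAf\<close> that is not a multiple of the idempotent \<open>f\<close> becomes a
  nonzero zero divisor after subtraction of an eigenvalue. Regularity turns that zero divisor into a
  proper nonzero idempotent of \<open>fAf\<close> (\<open>split_idempotent\<close>). A decomposition of \<open>1\<close> into the largest
  possible number of orthogonal idempotents therefore has all its corners equal to \<open>K\<close>. Two
  members \<open>f\<close>, \<open>g\<close> either satisfy \<open>fAg = 0\<close> or are linked by elements \<open>z \<in> fAg\<close> and \<open>w \<in> gAf\<close> with
  \<open>zw = f\<close> and \<open>wz = g\<close>. Grouping linked idempotents gives matrix units
  \<open>e\<^sup>i\<^sub>p\<^sub>q\<close> (\<open>exists_matrix_units\<close>), hence \<open>A \<cong> End(\<alpha>)\<close>; the vertices are the groups. Because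
  \<open>\<zeta>(ab) = \<zeta>(ba)\<close>, the map \<open>\<zeta>\<close> is determined by its values \<open>\<zeta>(e\<^sup>i\<^sub>0\<^sub>0)\<close>, which are the \<open>\<lambda>\<^sub>i\<close>.

  The bimodule. With \<open>e\<^sub>i = e\<^sup>i\<^sub>0\<^sub>0\<close>, the corners \<open>V\<^sub>i\<^sub>j = e\<^sub>iMe\<^sub>j\<close> determine \<open>M\<close>: an element \<open>x\<close> is
  given by its entries \<open>e\<^sup>i\<^sub>0\<^sub>p x e\<^sup>j\<^sub>q\<^sub>0 \<in> V\<^sub>i\<^sub>j\<close>. A basis of each \<open>V\<^sub>i\<^sub>j\<close>, regarded as a set of arrows
  from \<open>j\<close> to \<open>i\<close>, thus identifies \<open>M\<close> with the representations of a quiver (\<open>to_Rep_iso\<close>).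

  The form. Since \<open>\<omega>\<close> is balanced and alternating, elements of \<open>A\<close> can be moved across it on both
  sides, so \<open>\<omega>\<close> pairs \<open>V\<^sub>i\<^sub>j\<close> with \<open>V\<^sub>j\<^sub>i\<close> perfectly and all other pairs of corners trivially. The
  sum of the corners consequently has a Darboux basis \<open>u\<^sub>a\<close>, \<open>v\<^sub>a\<close> of
  homogeneous elements, \<open>u\<^sub>a\<close> lying in some \<open>V\<^sub>i\<^sub>j\<close> and \<open>v\<^sub>a\<close> in \<open>V\<^sub>j\<^sub>i\<close>
  (\<open>exists_homogeneous_darboux_basis\<close>). Taking \<open>u\<^sub>a\<close> as an arrow \<open>a\<close> of \<open>Q\<close> and \<open>v\<^sub>a\<close> as its reverse
  \<open>a\<^sup>*\<close>, the expression of \<open>\<omega>\<close> in coordinates is the form of the quiver.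
\<close>

section \<open>Eigenvectors over an algebraically closed field\<close>

text \<open>
  The family is indexed, so that it may repeat vectors: the iterates of an operator are in general
  not distinct.
\<close>

lemma (in finite_dimensional_vector_space) nontrivial_relation:
  fixes v :: "'i \<Rightarrow> 'b"
  assumes "finite S" "dimension < card S"
  shows "\<exists>c. (\<Sum>s\<in>S. c s *s v s) = 0 \<and> (\<exists>s\<in>S. c s \<noteq> 0)"
proof (cases "inj_on v S")
  case True
  have "dependent (v ` S)"
    using assms True independent_card_le_dim[of "v ` S" UNIV] dim_UNIV card_image[OF True]
    by (auto simp: dimension_def)
  then obtain c where c: "\<exists>x\<in>v ` S. c x \<noteq> 0" "(\<Sum>x\<in>v ` S. c x *s x) = 0"
    using dependent_finite[of "v ` S"] assms(1) by auto
  with True have "(\<Sum>s\<in>S. c (v s) *s v s) = 0"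
    by (simp add: sum.reindex)
  with c show ?thesis by (intro exI[of _ "\<lambda>s. c (v s)"]) auto
next
  case False
  then obtain s t where st: "s \<in> S" "t \<in> S" "s \<noteq> t" "v s = v t"
    by (auto simp: inj_on_def)
  define c :: "'i \<Rightarrow> 'a" where "c = (\<lambda>x. if x = s then 1 else if x = t then - 1 else 0)"
  have "(\<Sum>x\<in>S. c x *s v x) = (\<Sum>x\<in>{s, t}. c x *s v x)"
    using st assms(1) by (intro sum.mono_neutral_right) (auto simp: c_def)
  also have "\<dots> = 0"
    using st by (simp add: c_def)
  finally show ?thesis
    using st by (intro exI[of _ c]) (auto simp: c_def)
qed


text \<open>
  The vector \<open>p(T) x\<close>. The operators of a space given by a locale do not form a type in which \<open>p\<close>
  itself could be evaluated.
\<close>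

definition (in vector_space) poly_apply :: "'a poly \<Rightarrow> ('b \<Rightarrow> 'b) \<Rightarrow> 'b \<Rightarrow> 'b" where
  "poly_apply p T x = (\<Sum>i\<le>degree p. coeff p i *s (T ^^ i) x)"

context vector_space
begin

lemma poly_apply_bound:
  assumes "degree p \<le> n"
  shows "poly_apply p T x = (\<Sum>i\<le>n. coeff p i *s (T ^^ i) x)"
  unfolding poly_apply_def
  by (rule sum.mono_neutral_left) (use assms in \<open>auto simp: coeff_eq_0\<close>)

lemma poly_apply_linear_factor:
  assumes T: "Vector_Spaces.linear scale scale T"
  shows "poly_apply ([:- c, 1:] * q) T x = T (poly_apply q T x) - c *s poly_apply q T x"
proof -
  interpret T: Vector_Spaces.linear scale scale T by (rule T)
  let ?n = "degree q"
  let ?S = "\<lambda>f m. \<Sum>i\<le>m. f i *s (T ^^ i) x"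
  have eq: "[:- c, 1:] * q = pCons 0 q - Polynomial.smult c q" by simp
  have "degree ([:- c, 1:] * q) \<le> Suc ?n"
    using degree_mult_le[of "[:- c, 1:]" q] by simp
  then have "poly_apply ([:- c, 1:] * q) T x = ?S (coeff (pCons 0 q - Polynomial.smult c q)) (Suc ?n)"
    unfolding eq by (rule poly_apply_bound)
  also have "\<dots> = ?S (coeff (pCons 0 q)) (Suc ?n) - ?S (coeff (Polynomial.smult c q)) (Suc ?n)"
    by (simp only: coeff_diff scale_left_diff_distrib sum_subtractf)
  also have "?S (coeff (pCons 0 q)) (Suc ?n) = T (?S (coeff q) ?n)"
    by (subst sum.atMost_Suc_shift) (simp add: T.sum T.scale)
  also have "?S (coeff q) ?n = poly_apply q T x"
    by (simp add: poly_apply_def)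
  also have "?S (coeff (Polynomial.smult c q)) (Suc ?n) = c *s ?S (coeff q) (Suc ?n)"
    by (simp add: scale_sum_right scale_right_distrib)
  also have "?S (coeff q) (Suc ?n) = poly_apply q T x"
    by (rule poly_apply_bound[symmetric]) simp
  finally show ?thesis .
qed

end

text \<open>
  Take a nonzero \<open>p\<close> of least degree with \<open>p(T) w\<^sub>0 = 0\<close> and a root \<open>c\<close> of it, so that
  \<open>p = (X - c) q\<close>. By minimality \<open>q(T) w\<^sub>0\<close> does not vanish, but \<open>T - c\<close> annihilates it.
\<close>

lemma eigenvector_in_invariant_subspace:
  fixes scale :: "'k::alg_closed_field \<Rightarrow> 'v::ab_group_add \<Rightarrow> 'v"
  assumes fd: "finite_dimensional_vector_space scale Basis"
    and T: "Vector_Spaces.linear scale scale T"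
    and W: "module.subspace scale W" "\<And>w. w \<in> W \<Longrightarrow> T w \<in> W" "w0 \<in> W" "w0 \<noteq> 0"
  shows "\<exists>c. \<exists>w\<in>W. w \<noteq> 0 \<and> T w = scale c w"
proof -
  interpret finite_dimensional_vector_space scale Basis by (rule fd)
  have iter: "(T ^^ i) w0 \<in> W" for i
    using W by (induction i) auto
  define P where "P = (\<lambda>p. p \<noteq> 0 \<and> poly_apply p T w0 = 0)"
  have "\<exists>p. P p"
  proof -
    have "dimension < card {..dimension}" by simp
    then obtain c where c: "(\<Sum>i\<le>dimension. scale (c i) ((T ^^ i) w0)) = 0" "\<exists>i\<le>dimension. c i \<noteq> 0"
      using nontrivial_relation[of "{..dimension}" "\<lambda>i. (T ^^ i) w0"] by auto
    define p where "p = (\<Sum>i\<le>dimension. monom (c i) i)"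
    have cp: "coeff p i = (if i \<le> dimension then c i else 0)" for i
      by (simp add: p_def coeff_sum sum.delta')
    have "degree p \<le> dimension"
      by (rule degree_le) (simp add: cp)
    then have "poly_apply p T w0 = 0"
      using c(1) by (simp add: poly_apply_bound cp)
    moreover have "p \<noteq> 0"
      using c(2) cp by (metis coeff_0)
    ultimately show ?thesis by (auto simp: P_def)
  qed
  then obtain p where p: "P p" "\<And>q. P q \<Longrightarrow> degree p \<le> degree q"
    by (metis ex_has_least_nat)
  have "degree p \<noteq> 0"
  proof
    assume "degree p = 0"
    then obtain a where "p = [:a:]" by (rule degree_eq_zeroE)
    then show False
      using p(1) W(4) by (auto simp: P_def poly_apply_def)
  qed
  then obtain c where "poly p c = 0"
    using alg_closed_imp_poly_has_root[of p] by auto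
  then obtain q where q: "p = [:- c, 1:] * q"
    by (auto simp: poly_eq_0_iff_dvd)
  then have "q \<noteq> 0" using p(1) by (auto simp: P_def)
  then have "degree q < degree p"
    unfolding q by (subst degree_mult_eq) auto
  with p(2)[of q] \<open>q \<noteq> 0\<close> have "poly_apply q T w0 \<noteq> 0"
    by (auto simp: P_def)
  moreover have "poly_apply q T w0 \<in> W"
    unfolding poly_apply_def by (intro subspace_sum subspace_scale W(1) iter)
  moreover have "T (poly_apply q T w0) = scale c (poly_apply q T w0)"
    using p(1) poly_apply_linear_factor[OF T, of c q w0] by (simp add: P_def q)
  ultimately show ?thesis by blast
qed

section \<open>Idempotents in a semisimple algebra\<close>

text \<open>
  A complement \<open>L'\<close> of the left ideal \<open>Az\<close> yields \<open>1 = az + y\<close> with \<open>y \<in> L'\<close>. Then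
  \<open>zy = z - zaz\<close> lies both in \<open>Az\<close> and in \<open>L'\<close>, hence vanishes.
\<close>

lemma semisimple_ring_von_neumann_regular:
  fixes z :: "'a::{ring, monoid_mult}"
  assumes "semisimple_ring TYPE('a)"
  obtains a where "z * a * z = z"
proof -
  define L where "L = range (\<lambda>a. a * z)"
  have L: "left_ideal L"
    unfolding left_ideal_def L_def
  proof (intro conjI ballI allI)
    show "0 \<in> range (\<lambda>a. a * z)" by (metis mult_zero_left rangeI)
    show "x + y \<in> range (\<lambda>a. a * z)"
      if "x \<in> range (\<lambda>a. a * z)" "y \<in> range (\<lambda>a. a * z)" for x y
      using that by (auto simp: distrib_right[symmetric])
    show "b * x \<in> range (\<lambda>a. a * z)" if "x \<in> range (\<lambda>a. a * z)" for b x
      using that by (auto simp: mult.assoc[symmetric])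
  qed
  moreover have "left_ideal L \<longrightarrow>
      (\<exists>L'. left_ideal L' \<and> L \<inter> L' = {0} \<and> {x + y | x y. x \<in> L \<and> y \<in> L'} = UNIV)"
    using assms unfolding semisimple_ring_def by (rule spec)
  ultimately obtain L' where L': "left_ideal L'" "L \<inter> L' = {0}"
    "{x + y | x y. x \<in> L \<and> y \<in> L'} = UNIV"
    by (elim impE exE conjE)
  have "1 \<in> {x + y | x y. x \<in> L \<and> y \<in> L'}" unfolding L'(3) ..
  then obtain a y where y: "1 = a * z + y" "y \<in> L'"
    unfolding L_def by blast
  have "z = z * (a * z + y)" using y by simp
  then have zy: "z * y = (1 - z * a) * z"
    by (simp add: algebra_simps)
  then have "z * y \<in> L"
    unfolding L_def by blast
  moreover have "z * y \<in> L'"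
    using L'(1) y(2) by (simp add: left_ideal_def)
  ultimately have "z * y = 0" using L'(2) by blast
  then show ?thesis using that[of a] zy by (simp add: algebra_simps)
qed

locale fd_semisimple_algebra = k_algebra scale + finite_dimensional_vector_space scale Basis
  for scale :: "'k::alg_closed_field \<Rightarrow> 'a::{ring, monoid_mult} \<Rightarrow> 'a" and Basis :: "'a set" +
  assumes semisimple: "semisimple_ring TYPE('a)"
begin

lemma linear_mult_left: "Vector_Spaces.linear scale scale (\<lambda>w. x * w)"
  by unfold_locales (simp_all add: distrib_left scale_mult_right scale_right_distrib scale_left_distrib)

definition idempotent_decomposition :: "'a set \<Rightarrow> bool" where
  "idempotent_decomposition F \<longleftrightarrow>
     finite F \<and> (\<forall>f\<in>F. f * f = f \<and> f \<noteq> 0) \<and> (\<forall>f\<in>F. \<forall>g\<in>F. f \<noteq> g \<longrightarrow> f * g = 0) \<and> \<Sum>F = 1"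

text \<open>
  Left multiplication by \<open>x\<close> preserves \<open>fA\<close> and has an eigenvalue \<open>c\<close> there, so that
  \<open>z = x - cf\<close> is nonzero but annihilates some nonzero \<open>w \<in> fA\<close>. If \<open>zaz = z\<close>, then \<open>q = faz\<close> is
  idempotent. It is nonzero because \<open>zq = z\<close>, and differs from \<open>f\<close> because \<open>qw = 0\<close>.
\<close>

lemma split_idempotent:
  assumes f: "f * f = f" "f \<noteq> 0" and x: "f * x * f = x" "\<And>c. x \<noteq> scale c f"
  obtains q where "q * q = q" "q \<noteq> 0" "q \<noteq> f" "f * q = q" "q * f = q"
proof -
  have W: "subspace {w. f * w = w}"
    unfolding subspace_def by (auto simp: distrib_left scale_mult_right[symmetric])
  have "f * (x * w) = x * w" if "f * w = w" for w
    using x(1) f(1) by (metis mult.assoc)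
  with f obtain c w where w: "f * w = w" "w \<noteq> 0" "x * w = scale c w"
    using eigenvector_in_invariant_subspace[OF finite_dimensional_vector_space_axioms
        linear_mult_left[of x] W, of f] by auto
  define z where "z = x - scale c f"
  have fx: "f * x = x" "x * f = x"
    using x(1) f(1) by (metis mult.assoc)+
  then have fz: "f * z = z" "z * f = z"
    using f(1) by (simp_all add: z_def left_diff_distrib right_diff_distrib
        scale_mult_left[symmetric] scale_mult_right[symmetric])
  have "z \<noteq> 0" using x(2)[of c] by (simp add: z_def)
  have "z * w = 0"
    using w by (simp add: z_def left_diff_distrib scale_mult_left[symmetric])
  obtain a where a: "z * a * z = z"
    by (rule semisimple_ring_von_neumann_regular[OF semisimple])
  define q where "q = f * a * z"
  have zq: "z * q = z"
    using a fz unfolding q_def by (metis mult.assoc)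
  have "q * q = q"
    using zq unfolding q_def by (simp add: mult.assoc)
  moreover have "q \<noteq> 0" using zq \<open>z \<noteq> 0\<close> by auto
  moreover have "q \<noteq> f"
  proof
    assume "q = f"
    then have "w = q * w" using w by simp
    also have "\<dots> = 0" using \<open>z * w = 0\<close> by (simp add: q_def mult.assoc)
    finally show False using w by simp
  qed
  moreover have "f * q = q" "q * f = q"
    using f fz by (simp_all add: q_def mult.assoc) (simp add: mult.assoc[symmetric])
  ultimately show ?thesis using that by blast
qed

text \<open>
  Nonzero orthogonal idempotents are linearly independent: multiplication by one of them isolates its
  coefficient in a linear relation.
\<close>

lemma card_idempotent_decomposition_le:
  assumes "idempotent_decomposition F"
  shows "card F \<le> dimension"
proof (rule ccontr)
  assume "\<not> ?thesis"
  moreover have F: "finite F" "\<And>f. f \<in> F \<Longrightarrow> f * f = f" "\<And>f. f \<in> F \<Longrightarrow> f \<noteq> 0"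
    "\<And>f g. f \<in> F \<Longrightarrow> g \<in> F \<Longrightarrow> f \<noteq> g \<Longrightarrow> f * g = 0"
    using assms by (auto simp: idempotent_decomposition_def)
  ultimately obtain c f where c: "(\<Sum>g\<in>F. scale (c g) g) = 0" "f \<in> F" "c f \<noteq> 0"
    using nontrivial_relation[of F "\<lambda>f. f"] by auto
  have "0 = f * (\<Sum>g\<in>F. scale (c g) g)" using c by simp
  also have "\<dots> = (\<Sum>g\<in>F. if f = g then scale (c f) f else 0)"
    unfolding sum_distrib_left
    by (rule sum.cong) (use F c in \<open>auto simp: scale_mult_right[symmetric]\<close>)
  also have "\<dots> = scale (c f) f" using c F by simp
  finally show False using F c by simp
qed

text \<open>
  A decomposition with the largest number of members will do: if the corner of a member \<open>f\<close> were not
  scalar, \<open>f\<close> could be replaced by \<open>q\<close> and \<open>f - q\<close> for an idempotent \<open>q\<close> of that corner.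
\<close>

lemma exists_decomposition_with_scalar_corners:
  "\<exists>F. idempotent_decomposition F \<and> (\<forall>f\<in>F. \<forall>x. \<exists>c. f * x * f = scale c f)"
proof -
  \<comment> \<open>The zero algebra needs the empty decomposition, since members are nonzero.\<close>
  have "idempotent_decomposition (if (1::'a) = 0 then {} else {1})"
    by (auto simp: idempotent_decomposition_def)
  moreover have "\<forall>G. idempotent_decomposition G \<longrightarrow> card G < Suc dimension"
    using card_idempotent_decomposition_le by (simp add: less_Suc_eq_le)
  ultimately obtain F where F: "idempotent_decomposition F"
    and max: "\<And>G. idempotent_decomposition G \<Longrightarrow> card G \<le> card F"
    using ex_has_greatest_nat[of idempotent_decomposition _ card "Suc dimension"] by blast
  have F': "finite F" "\<And>f. f \<in> F \<Longrightarrow> f * f = f" "\<And>f. f \<in> F \<Longrightarrow> f \<noteq> 0"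
    "\<And>f g. f \<in> F \<Longrightarrow> g \<in> F \<Longrightarrow> f \<noteq> g \<Longrightarrow> f * g = 0" "\<Sum>F = 1"
    using F by (auto simp: idempotent_decomposition_def)
  have "\<exists>c. f * x * f = scale c f" if f: "f \<in> F" for f x
  proof (rule ccontr)
    assume "\<nexists>c. f * x * f = scale c f"
    moreover have "f * (f * x * f) * f = f * x * f"
      using F'(2)[OF f] by (metis mult.assoc)
    ultimately obtain q where q: "q * q = q" "q \<noteq> 0" "q \<noteq> f" "f * q = q" "q * f = q"
      using split_idempotent[of f "f * x * f"] F'(2,3)[OF f] by metis
    let ?H = "F - {f}" and ?q' = "f - q"
    have q': "?q' * ?q' = ?q'" "?q' \<noteq> 0" "q * ?q' = 0" "?q' * q = 0" "f * ?q' = ?q'" "?q' * f = ?q'"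
      using q F'(2)[OF f] by (auto simp: algebra_simps)
    have orth: "p * h = 0 \<and> h * p = 0" if "f * p = p" "p * f = p" "h \<in> ?H" for p h
      using that f F'(4)[of f h] F'(4)[of h f]
      by (metis Diff_iff insertI1 mult.assoc mult_zero_left mult_zero_right)
    have notin: "p \<notin> ?H" if "f * p = p" "p \<noteq> 0" for p
      using that f F'(4)[of f p] by auto
    have "q \<noteq> ?q'" using q q' by auto
    let ?G = "insert q (insert ?q' ?H)"
    have "\<Sum>?G = q + (?q' + \<Sum>?H)"
      using \<open>q \<noteq> ?q'\<close> notin[of q] notin[of ?q'] q q' F'(1) by simp
    also have "\<dots> = \<Sum>F"
      using F'(1) f by (simp add: sum.remove[of F f "\<lambda>x. x"])
    finally have "\<Sum>?G = 1" using F' by simp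
    moreover have "\<forall>g\<in>?G. g * g = g \<and> g \<noteq> 0"
      using F'(2,3) q(1,2) q'(1,2) by auto
    moreover have "\<forall>g\<in>?G. \<forall>h\<in>?G. g \<noteq> h \<longrightarrow> g * h = 0"
      using F'(4) q' orth[OF q(4,5)] orth[OF q'(5,6)] by blast
    moreover have "finite ?G" using F'(1) by simp
    ultimately have "idempotent_decomposition ?G"
      unfolding idempotent_decomposition_def by blast
    then have "card ?G \<le> card F" by (rule max)
    moreover have "card ?G = Suc (Suc (card ?H))"
      using \<open>q \<noteq> ?q'\<close> notin[of q] notin[of ?q'] q q' F'(1) by simp
    moreover have "Suc (card ?H) = card F"
      using F'(1) f by (metis card_Suc_Diff1)
    ultimately show False by simp
  qed
  with F show ?thesis by blast
qed

end

section \<open>Matrix units\<close>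

text \<open>
  The unit in position \<open>(p, q)\<close> of the \<open>i\<close>-th of \<open>n\<close> matrix blocks is \<open>e i p q\<close>, and \<open>\<alpha> i\<close> is the size
  of that block. That the units form a basis is encoded by conditions on the corners of the
  idempotents \<open>e i 0 0\<close> alone; every other corner is carried into one of these by multiplication with
  units. Sizes are positive so that every block has a position \<open>0\<close>.
\<close>

locale matrix_units = k_algebra scale
  for scale :: "'k::field \<Rightarrow> 'a::{ring, monoid_mult} \<Rightarrow> 'a" +
  fixes n :: nat and \<alpha> :: "nat \<Rightarrow> nat" and e :: "nat \<Rightarrow> nat \<Rightarrow> nat \<Rightarrow> 'a"
  assumes size_pos: "i < n \<Longrightarrow> 0 < \<alpha> i"
    and unit_mult: "\<lbrakk>i < n; p < \<alpha> i; q < \<alpha> i; j < n; s < \<alpha> j; t < \<alpha> j\<rbrakk> \<Longrightarrow>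
      e i p q * e j s t = (if i = j \<and> q = s then e i p t else 0)"
    and sum_diag: "(\<Sum>i<n. \<Sum>p<\<alpha> i. e i p p) = 1"
    and unit_nonzero: "i < n \<Longrightarrow> e i 0 0 \<noteq> 0"
    and scalar_corner: "i < n \<Longrightarrow> \<exists>c. e i 0 0 * a * e i 0 0 = scale c (e i 0 0)"
    and zero_corner: "\<lbrakk>i < n; j < n; i \<noteq> j\<rbrakk> \<Longrightarrow> e i 0 0 * a * e j 0 0 = 0"

context fd_semisimple_algebra
begin

text \<open>
  Let \<open>y = fxg\<close> be nonzero and \<open>yby = y\<close>. The elements \<open>ybf\<close> and \<open>gby\<close> lie in scalar corners, so
  they are \<open>cf\<close> and \<open>dg\<close>; since both fix \<open>y\<close> (from the left and from the right), \<open>c = d = 1\<close>. Hence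
  \<open>y\<close> and \<open>gbf\<close> are mutually inverse.
\<close>

lemma scalar_corners_linked:
  assumes f: "f * f = f" "\<And>x. \<exists>c. f * x * f = scale c f"
    and g: "g * g = g" "\<And>x. \<exists>c. g * x * g = scale c g"
    and nz: "f * x * g \<noteq> 0"
  shows "\<exists>z w. f * z = z \<and> z * g = z \<and> g * w = w \<and> w * f = w \<and> z * w = f \<and> w * z = g"
proof -
  define y where "y = f * x * g"
  have y: "f * y = y" "y * g = y" "y \<noteq> 0"
    using nz by (simp_all add: y_def mult.assoc g(1)) (simp add: mult.assoc[symmetric] f(1))
  obtain b where b: "y * b * y = y"
    by (rule semisimple_ring_von_neumann_regular[OF semisimple])
  have eq_1: "c = 1" if "scale c y = y" for c
  proof -
    have "scale c y = scale 1 y" unfolding scale_one by (rule that)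
    with y(3) show ?thesis by (simp only: scale_cancel_right) simp
  qed
  obtain c where "f * (y * b) * f = scale c f" using f(2) by blast
  then have c: "y * b * f = scale c f" by (simp add: mult.assoc[symmetric] y(1))
  have "y * b * f * y = y" using b y(1) by (simp add: mult.assoc)
  then have "scale c y = y" by (simp add: c scale_mult_left[symmetric] y(1))
  then have "c = 1" by (rule eq_1)
  obtain d where "g * (b * y) * g = scale d g" using g(2) by blast
  then have d: "g * b * y = scale d g" by (simp add: mult.assoc y(2))
  have "y * (g * b * y) = y" using b by (simp add: mult.assoc[symmetric] y(2))
  then have "scale d y = y" by (simp add: d scale_mult_right[symmetric] y(2))
  then have "d = 1" by (rule eq_1)
  let ?w = "g * b * f"
  have "y * ?w = f" using c \<open>c = 1\<close> by (simp add: mult.assoc[symmetric] y(2))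
  moreover have "?w * y = g" using d y(1) \<open>d = 1\<close> by (simp add: mult.assoc)
  moreover have "g * ?w = ?w" "?w * f = ?w"
    by (simp_all add: mult.assoc f(1)) (simp add: mult.assoc[symmetric] g(1))
  ultimately show ?thesis using y by blast
qed

text \<open>
  Being linked is an equivalence relation on a decomposition of \<open>1\<close> with scalar corners. Its classes
  are the blocks. If \<open>h\<^sub>0, h\<^sub>1, \<dots>\<close> are the members of a class and \<open>z\<^sub>p \<in> h\<^sub>0Ah\<^sub>p\<close>, \<open>w\<^sub>p \<in> h\<^sub>pAh\<^sub>0\<close> link
  them to \<open>h\<^sub>0\<close>, the units of that block are \<open>w\<^sub>pz\<^sub>q\<close>.
\<close>

theorem exists_matrix_units: "\<exists>n \<alpha> e. matrix_units scale n \<alpha> e"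
proof -
  obtain F where "idempotent_decomposition F"
    and corner: "\<And>f x. f \<in> F \<Longrightarrow> \<exists>c. f * x * f = scale c f"
    using exists_decomposition_with_scalar_corners by blast
  then have finF: "finite F" and idem: "\<And>f. f \<in> F \<Longrightarrow> f * f = f"
    and nz: "\<And>f. f \<in> F \<Longrightarrow> f \<noteq> 0"
    and orth: "\<And>f g. f \<in> F \<Longrightarrow> g \<in> F \<Longrightarrow> f \<noteq> g \<Longrightarrow> f * g = 0"
    and sumF: "\<Sum>F = 1"
    by (auto simp: idempotent_decomposition_def)
  define R where "R = {(f, g). f \<in> F \<and> g \<in> F \<and> (\<exists>x. f * x * g \<noteq> 0)}"
  have linked: "\<exists>z w. f * z = z \<and> z * g = z \<and> g * w = w \<and> w * f = w \<and> z * w = f \<and> w * z = g"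
    if "(f, g) \<in> R" for f g
  proof -
    from that obtain x where x: "f \<in> F" "g \<in> F" "f * x * g \<noteq> 0"
      by (auto simp: R_def)
    show ?thesis
      by (rule scalar_corners_linked[OF idem[OF x(1)] corner[OF x(1)] idem[OF x(2)] corner[OF x(2)] x(3)])
  qed
  have "equiv F R"
  proof (rule equivI)
    show "R \<subseteq> F \<times> F" by (auto simp: R_def)
    show "refl_on F R"
    proof (rule refl_onI)
      fix f assume f: "f \<in> F"
      then have "f * 1 * f \<noteq> 0" using idem nz by simp
      with f show "(f, f) \<in> R" unfolding R_def by blast
    qed
    show "sym R"
    proof (rule symI)
      fix f g assume fg: "(f, g) \<in> R"
      then obtain z w where "g * w = w" "w * f = w" "z * w = f" using linked by blast
      moreover have "f \<in> F" "g \<in> F" using fg by (auto simp: R_def)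
      ultimately have "g * w * f \<noteq> 0" using nz[of f] by auto
      with \<open>f \<in> F\<close> \<open>g \<in> F\<close> show "(g, f) \<in> R" unfolding R_def by blast
    qed
    show "trans R"
    proof (rule transI)
      fix f g h assume fg: "(f, g) \<in> R" and gh: "(g, h) \<in> R"
      have F: "f \<in> F" "g \<in> F" "h \<in> F" using fg gh by (auto simp: R_def)
      obtain z w where z: "f * z = z" "z * g = z" "w * z = g"
        using linked[OF fg] by blast
      obtain z' w' where z': "g * z' = z'" "z' * h = z'" "w' * z' = h"
        using linked[OF gh] by blast
      \<comment> \<open>The product of the two links is nonzero, because \<open>w\<close> recovers \<open>z'\<close> from it.\<close>
      have "w * (f * (z * z') * h) = w * (z * z')"
        using z(1) z'(2) by (simp add: mult.assoc) (simp add: mult.assoc[symmetric])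
      also have "\<dots> = z'" using z(3) z'(1) by (simp add: mult.assoc[symmetric])
      finally have "f * (z * z') * h \<noteq> 0" using z'(3) nz[OF F(3)] by auto
      with F show "(f, h) \<in> R" unfolding R_def by blast
    qed
  qed
  define n where "n = card (F // R)"
  have "finite (F // R)" using finF \<open>equiv F R\<close> by (auto simp: equiv_def intro: finite_quotient)
  then obtain cls where cls: "bij_betw cls {..<n} (F // R)"
    unfolding n_def by (metis ex_bij_betw_nat_finite atLeast0LessThan)
  have clsQ: "cls i \<in> F // R" if "i < n" for i
    using that bij_betwE[OF cls] by simp
  have cls_sub: "cls i \<subseteq> F" if "i < n" for i
    using clsQ[OF that] \<open>equiv F R\<close> by (metis Sup_upper Union_quotient)
  define \<alpha> where "\<alpha> i = card (cls i)" for i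
  have "\<exists>h. bij_betw h {..<\<alpha> i} (cls i)" if "i < n" for i
    unfolding \<alpha>_def using finite_subset[OF cls_sub[OF that] finF]
    by (metis ex_bij_betw_nat_finite atLeast0LessThan)
  then obtain h where h: "\<And>i. i < n \<Longrightarrow> bij_betw (h i) {..<\<alpha> i} (cls i)"
    by metis
  have h_cls: "h i p \<in> cls i" if "i < n" "p < \<alpha> i" for i p
    using that bij_betwE[OF h] by simp
  have hF: "h i p \<in> F" if "i < n" "p < \<alpha> i" for i p
    using h_cls[OF that] cls_sub[OF that(1)] by blast
  have pos: "0 < \<alpha> i" if "i < n" for i
    unfolding \<alpha>_def using finite_subset[OF cls_sub[OF that] finF] clsQ[OF that] \<open>equiv F R\<close>
    by (metis card_gt_0_iff in_quotient_imp_non_empty)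
  have h_R: "(h i p, h i q) \<in> R" if "i < n" "p < \<alpha> i" "q < \<alpha> i" for i p q
    using quotient_eq_iff[OF \<open>equiv F R\<close> clsQ[OF that(1)] clsQ[OF that(1)]] h_cls that by blast
  \<comment> \<open>A nonzero \<open>fAg\<close> occurs only inside a class; this makes distinct blocks annihilate each other.\<close>
  have same_cls: "i = j" if "i < n" "j < n" "(f, g) \<in> R" "f \<in> cls i" "g \<in> cls j" for i j f g
    using quotient_eq_iff[OF \<open>equiv F R\<close> clsQ[OF that(1)] clsQ[OF that(2)] that(4,5)] that(1-3)
      cls by (metis bij_betw_imp_inj_on inj_onD lessThan_iff)
  have h_inj: "i = j \<and> p = q" if "i < n" "j < n" "p < \<alpha> i" "q < \<alpha> j" "h i p = h j q" for i j p q
  proof -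
    have "i = j"
      using same_cls[OF that(1,2) h_R[OF that(1,3,3)]] h_cls that by metis
    with that show ?thesis
      using bij_betw_imp_inj_on[OF h[OF that(1)]] by (auto simp: inj_on_def)
  qed
  define linkage where "linkage = (\<lambda>i p z w. h i 0 * z = z \<and> z * h i p = z \<and>
      h i p * w = w \<and> w * h i 0 = w \<and> z * w = h i 0 \<and> w * z = h i p)"
  have "\<forall>i p. \<exists>z w. i < n \<longrightarrow> p < \<alpha> i \<longrightarrow> linkage i p z w"
    using linked h_R pos unfolding linkage_def by meson
  then obtain z w where "\<And>i p. i < n \<Longrightarrow> p < \<alpha> i \<Longrightarrow> linkage i p (z i p) (w i p)"
    by metis
  then have zw:
    "h i 0 * z i p = z i p" "z i p * h i p = z i p" "h i p * w i p = w i p" "w i p * h i 0 = w i p"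
    "z i p * w i p = h i 0" "w i p * z i p = h i p" if "i < n" "p < \<alpha> i" for i p
    using that by (auto simp: linkage_def)
  define e where "e i p q = w i p * z i q" for i p q
  have diag: "e i p p = h i p" if "i < n" "p < \<alpha> i" for i p
    using zw(6)[OF that] by (simp add: e_def)
  have "matrix_units scale n \<alpha> e"
  proof (unfold_locales)
    show "0 < \<alpha> i" if "i < n" for i using pos that .
    show "e i 0 0 \<noteq> 0" if "i < n" for i
      using that diag pos nz hF by simp
    show "\<exists>c. e i 0 0 * a * e i 0 0 = scale c (e i 0 0)" if "i < n" for i a
      using that diag pos corner hF by simp
    show "e i 0 0 * a * e j 0 0 = 0" if "i < n" "j < n" "i \<noteq> j" for i j a
    proof (rule ccontr)
      assume "e i 0 0 * a * e j 0 0 \<noteq> 0"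
      then have "(h i 0, h j 0) \<in> R"
        using that diag pos hF by (auto simp: R_def)
      then show False using same_cls[of i j] h_cls pos that by blast
    qed
    show "e i p q * e j s t = (if i = j \<and> q = s then e i p t else 0)"
      if *: "i < n" "p < \<alpha> i" "q < \<alpha> i" "j < n" "s < \<alpha> j" "t < \<alpha> j" for i p q j s t
    proof (cases "i = j \<and> q = s")
      case True
      have "e i p q * e i q t = w i p * (z i q * w i q) * z i t"
        by (simp add: e_def mult.assoc)
      also have "\<dots> = e i p t" using True * by (simp add: zw e_def)
      finally show ?thesis using True by auto
    next
      case False
      then have "h i q * h j s = 0" using h_inj[of i j q s] orth hF * by blast
      then have "z i q * h i q * (h j s * w j s) = 0" by (metis mult.assoc mult_zero_left mult_zero_right)
      then have "z i q * w j s = 0" using zw * by simp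
      then have "e i p q * e j s t = 0"
        unfolding e_def by (metis mult.assoc mult_zero_left mult_zero_right)
      with False show ?thesis by auto
    qed
    have "(\<Sum>i<n. \<Sum>p<\<alpha> i. e i p p) = (\<Sum>i<n. \<Sum>p<\<alpha> i. h i p)"
      by (simp add: diag)
    also have "\<dots> = (\<Sum>i<n. \<Sum>(cls i))"
      using sum.reindex_bij_betw[OF h, of _ "\<lambda>x. x"] by simp
    also have "\<dots> = sum \<Sum> (F // R)"
      using sum.reindex_bij_betw[OF cls, of "\<lambda>C. \<Sum>C"] by simp
    also have "\<dots> = \<Sum>(\<Union>(F // R))"
    proof -
      have "\<forall>C\<in>F // R. finite C"
        using finF \<open>equiv F R\<close> by (metis Sup_upper Union_quotient finite_subset)
      moreover have "\<forall>C\<in>F // R. \<forall>D\<in>F // R. C \<noteq> D \<longrightarrow> C \<inter> D = {}"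
        using quotient_disj[OF \<open>equiv F R\<close>] by blast
      ultimately show ?thesis by (subst sum.Union_disjoint) auto
    qed
    also have "\<dots> = 1"
      using sumF Union_quotient[OF \<open>equiv F R\<close>] by simp
    finally show "(\<Sum>i<n. \<Sum>p<\<alpha> i. e i p p) = 1" .
  qed
  then show ?thesis by blast
qed

end

section \<open>Finite sums and traces of products\<close>

lemma double_sum_single:
  fixes F :: "'a \<Rightarrow> 'b \<Rightarrow> 'c::comm_monoid_add"
  assumes "finite A" "finite B" "p \<in> A" "q \<in> B"
    and "\<And>s t. s \<in> A \<Longrightarrow> t \<in> B \<Longrightarrow> F s t \<noteq> 0 \<Longrightarrow> s = p \<and> t = q"
  shows "(\<Sum>s\<in>A. \<Sum>t\<in>B. F s t) = F p q"
proof -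
  have "(\<Sum>s\<in>A. \<Sum>t\<in>B. F s t) = (\<Sum>(s, t)\<in>A \<times> B. F s t)"
    by (rule sum.cartesian_product)
  also have "\<dots> = (\<Sum>(s, t)\<in>{(p, q)}. F s t)"
  proof (rule sum.mono_neutral_right)
    show "finite (A \<times> B)" "{(p, q)} \<subseteq> A \<times> B"
      using assms(1-4) by auto
    show "\<forall>x\<in>A \<times> B - {(p, q)}. (case x of (s, t) \<Rightarrow> F s t) = 0"
    proof
      fix x assume x: "x \<in> A \<times> B - {(p, q)}"
      obtain s t where st: "x = (s, t)" by (cases x)
      with x have "F s t = 0" using assms(5)[of s t] by fastforce
      with st show "(case x of (s, t) \<Rightarrow> F s t) = 0" by simp
    qed
  qed
  finally show ?thesis by simp
qed

lemma sum_swap_innermost: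
  "(\<Sum>p\<in>P. \<Sum>q\<in>Q. \<Sum>a\<in>A. F p q a) = (\<Sum>a\<in>A. \<Sum>p\<in>P. \<Sum>q\<in>Q. F p q a)"
proof -
  have "(\<Sum>p\<in>P. \<Sum>q\<in>Q. \<Sum>a\<in>A. F p q a) = (\<Sum>p\<in>P. \<Sum>a\<in>A. \<Sum>q\<in>Q. F p q a)"
    by (intro sum.cong refl sum.swap)
  also have "\<dots> = (\<Sum>a\<in>A. \<Sum>p\<in>P. \<Sum>q\<in>Q. F p q a)"
    by (rule sum.swap)
  finally show ?thesis .
qed

lemma mat_trace_mult:
  assumes "A \<in> carrier_mat m k" "B \<in> carrier_mat k m"
  shows "mat_trace (A * B) = (\<Sum>p<m. \<Sum>q<k. A $$ (p, q) * B $$ (q, p))"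
  using assms
  by (auto simp: mat_trace_def diag_mat_def interv_sum_list_conv_sum_set_nat atLeast0LessThan
      scalar_prod_def intro!: sum.cong)

section \<open>The algebra as a product of matrix algebras\<close>

context matrix_units
begin

lemma corner_eq_iff: "i < n \<Longrightarrow> scale c (e i 0 0) = scale d (e i 0 0) \<longleftrightarrow> c = d"
  using unit_nonzero by simp

text \<open>
  The coefficient of \<open>e i p q\<close> in \<open>a\<close>, read off after the entry has been moved to position \<open>(0, 0)\<close>.
\<close>

definition coord :: "nat \<Rightarrow> nat \<Rightarrow> nat \<Rightarrow> 'a \<Rightarrow> 'k" where
  "coord i p q a = (THE c. e i 0 p * a * e i q 0 = scale c (e i 0 0))"

lemma coord_unique:
  assumes "i < n" "e i 0 p * a * e i q 0 = scale c (e i 0 0)"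
  shows "coord i p q a = c"
  unfolding coord_def using assms by (intro the_equality) (auto simp: corner_eq_iff unit_nonzero)

lemma unit_via_corner:
  assumes "i < n" "p < \<alpha> i" "q < \<alpha> i"
  shows "e i p 0 * e i 0 q = e i p q"
  using assms size_pos[of i] by (simp add: unit_mult)

lemma coord_eq:
  assumes "i < n" "p < \<alpha> i" "q < \<alpha> i"
  shows "e i 0 p * a * e i q 0 = scale (coord i p q a) (e i 0 0)"
proof -
  obtain c where "e i 0 0 * (e i 0 p * a * e i q 0) * e i 0 0 = scale c (e i 0 0)"
    using scalar_corner assms(1) by blast
  also have "e i 0 0 * (e i 0 p * a * e i q 0) * e i 0 0 = (e i 0 0 * e i 0 p) * a * (e i q 0 * e i 0 0)"
    by (simp only: mult.assoc)
  also have "\<dots> = e i 0 p * a * e i q 0"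
    using assms size_pos[of i] by (simp add: unit_mult)
  finally have "e i 0 p * a * e i q 0 = scale c (e i 0 0)" .
  with coord_unique[OF assms(1) this] show ?thesis by simp
qed

text \<open>
  The element \<open>e i 0 p * a * e j q 0\<close> lies in the corner between \<open>e i 0 0\<close> and \<open>e j 0 0\<close>.
\<close>

lemma off_diagonal_zero:
  assumes "i < n" "j < n" "i \<noteq> j" "p < \<alpha> i" "q < \<alpha> j"
  shows "e i 0 p * a * e j q 0 = 0"
proof -
  have "0 = e i 0 0 * (e i 0 p * a * e j q 0) * e j 0 0"
    using zero_corner assms by simp
  also have "\<dots> = (e i 0 0 * e i 0 p) * a * (e j q 0 * e j 0 0)"
    by (simp only: mult.assoc)
  also have "\<dots> = e i 0 p * a * e j q 0"
    using assms size_pos by (simp add: unit_mult)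
  finally show ?thesis ..
qed

lemma coord_add:
  assumes "i < n" "p < \<alpha> i" "q < \<alpha> i"
  shows "coord i p q (a + b) = coord i p q a + coord i p q b"
  using assms by (intro coord_unique) (simp_all add: distrib_left distrib_right coord_eq scale_left_distrib)

lemma coord_scale:
  assumes "i < n" "p < \<alpha> i" "q < \<alpha> i"
  shows "coord i p q (scale c a) = c * coord i p q a"
  using assms
  by (intro coord_unique)
     (simp_all add: scale_mult_left[symmetric] scale_mult_right[symmetric] coord_eq)

lemma coord_sum:
  assumes "i < n" "p < \<alpha> i" "q < \<alpha> i"
  shows "coord i p q (\<Sum>x\<in>X. f x) = (\<Sum>x\<in>X. coord i p q (f x))"
proof (induction X rule: infinite_finite_induct)
  case (insert x F)
  then show ?case using coord_add[OF assms] by simp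
qed (use assms in \<open>auto intro!: coord_unique\<close>)

lemma coord_one:
  assumes "i < n" "p < \<alpha> i" "q < \<alpha> i"
  shows "coord i p q 1 = (if p = q then 1 else 0)"
  using assms size_pos[of i] by (intro coord_unique) (simp_all add: unit_mult)

lemma coord_unit:
  assumes "i < n" "p < \<alpha> i" "q < \<alpha> i" "j < n" "s < \<alpha> j" "t < \<alpha> j"
  shows "coord i p q (e j s t) = (if i = j \<and> p = s \<and> q = t then 1 else 0)"
  using assms size_pos[of i] by (intro coord_unique) (auto simp: unit_mult)

text \<open>
  Insert \<open>1\<close>, the sum of all diagonal units, on the right; the blocks other than \<open>i\<close> contribute
  nothing.
\<close>

lemma row_expansion:
  assumes "i < n" "p < \<alpha> i"
  shows "e i 0 p * a = (\<Sum>s<\<alpha> i. scale (coord i p s a) (e i 0 s))"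
proof -
  have "e i 0 p * a * e j s s = (if i = j then scale (coord i p s a) (e i 0 s) else 0)"
    if "j < n" "s < \<alpha> j" for j s
  proof -
    have "e i 0 p * a * e j s s = e i 0 p * a * e j s 0 * e j 0 s"
      using unit_via_corner[of j s s] that by (simp only: mult.assoc)
    also have "\<dots> = (if i = j then scale (coord i p s a) (e i 0 0) * e i 0 s else 0)"
      using that assms by (auto simp: coord_eq off_diagonal_zero)
    also have "\<dots> = (if i = j then scale (coord i p s a) (e i 0 s) else 0)"
      using that assms size_pos[of i] by (auto simp: scale_mult_left[symmetric] unit_mult)
    finally show ?thesis .
  qed
  note * = this
  have "e i 0 p * a = e i 0 p * a * (\<Sum>j<n. \<Sum>s<\<alpha> j. e j s s)"
    by (simp add: sum_diag)
  also have "\<dots> = (\<Sum>j<n. \<Sum>s<\<alpha> j. e i 0 p * a * e j s s)"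
    by (simp only: sum_distrib_left)
  also have "\<dots> = (\<Sum>j<n. if i = j then \<Sum>s<\<alpha> i. scale (coord i p s a) (e i 0 s) else 0)"
    by (intro sum.cong refl) (auto simp: *)
  also have "\<dots> = (\<Sum>s<\<alpha> i. scale (coord i p s a) (e i 0 s))"
    using assms by simp
  finally show ?thesis .
qed

lemma column_expansion:
  assumes "i < n" "q < \<alpha> i"
  shows "a * e i q 0 = (\<Sum>s<\<alpha> i. scale (coord i s q a) (e i s 0))"
proof -
  have "e j s s * a * e i q 0 = (if i = j then scale (coord i s q a) (e i s 0) else 0)"
    if "j < n" "s < \<alpha> j" for j s
  proof -
    have "e j s s * a * e i q 0 = e j s 0 * (e j 0 s * a * e i q 0)"
      using unit_via_corner[of j s s] that by (simp only: mult.assoc[symmetric])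
    also have "\<dots> = (if i = j then e i s 0 * scale (coord i s q a) (e i 0 0) else 0)"
      using that assms by (auto simp: coord_eq off_diagonal_zero)
    also have "\<dots> = (if i = j then scale (coord i s q a) (e i s 0) else 0)"
      using that assms size_pos[of i] by (auto simp: scale_mult_right[symmetric] unit_mult)
    finally show ?thesis .
  qed
  note * = this
  have "a * e i q 0 = (\<Sum>j<n. \<Sum>s<\<alpha> j. e j s s) * (a * e i q 0)"
    by (simp add: sum_diag)
  also have "\<dots> = (\<Sum>j<n. \<Sum>s<\<alpha> j. e j s s * a * e i q 0)"
    by (simp only: sum_distrib_right mult.assoc)
  also have "\<dots> = (\<Sum>j<n. if i = j then \<Sum>s<\<alpha> i. scale (coord i s q a) (e i s 0) else 0)"
    by (intro sum.cong refl) (auto simp: *)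
  also have "\<dots> = (\<Sum>s<\<alpha> i. scale (coord i s q a) (e i s 0))"
    using assms by simp
  finally show ?thesis .
qed

lemma unit_expansion:
  "a = (\<Sum>i<n. \<Sum>p<\<alpha> i. \<Sum>q<\<alpha> i. scale (coord i p q a) (e i p q))"
proof -
  have *: "e i p p * a = (\<Sum>q<\<alpha> i. scale (coord i p q a) (e i p q))" if "i < n" "p < \<alpha> i" for i p
  proof -
    have "e i p p * a = e i p 0 * (e i 0 p * a)"
      using unit_via_corner[of i p p] that by (simp only: mult.assoc[symmetric])
    also have "\<dots> = (\<Sum>q<\<alpha> i. scale (coord i p q a) (e i p q))"
      using that by (simp add: row_expansion sum_distrib_left scale_mult_right[symmetric] unit_via_corner)
    finally show ?thesis .
  qed
  have "a = (\<Sum>i<n. \<Sum>p<\<alpha> i. e i p p) * a"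
    by (simp add: sum_diag)
  also have "\<dots> = (\<Sum>i<n. \<Sum>p<\<alpha> i. \<Sum>q<\<alpha> i. scale (coord i p q a) (e i p q))"
    by (simp add: sum_distrib_right *)
  finally show ?thesis .
qed

lemma coord_mult:
  assumes "i < n" "p < \<alpha> i" "q < \<alpha> i"
  shows "coord i p q (a * b) = (\<Sum>s<\<alpha> i. coord i p s a * coord i s q b)"
proof (rule coord_unique[OF assms(1)])
  have "e i 0 p * (a * b) * e i q 0 = e i 0 p * a * (b * e i q 0)"
    by (simp only: mult.assoc)
  also have "\<dots> = (\<Sum>s<\<alpha> i. scale (coord i p s a) (e i 0 s) * (b * e i q 0))"
    using assms by (simp add: row_expansion sum_distrib_right)
  also have "\<dots> = (\<Sum>s<\<alpha> i. scale (coord i p s a * coord i s q b) (e i 0 0))"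
    using assms by (intro sum.cong) (simp_all add: scale_mult_left[symmetric] mult.assoc[symmetric] coord_eq)
  also have "\<dots> = scale (\<Sum>s<\<alpha> i. coord i p s a * coord i s q b) (e i 0 0)"
    by (simp add: scale_sum_left)
  finally show "e i 0 p * (a * b) * e i q 0 = scale (\<Sum>s<\<alpha> i. coord i p s a * coord i s q b) (e i 0 0)" .
qed

definition to_End :: "'a \<Rightarrow> nat \<Rightarrow> 'k mat" where
  "to_End a = (\<lambda>i\<in>{..<n}. mat (\<alpha> i) (\<alpha> i) (\<lambda>(p, q). coord i p q a))"

lemma to_End_index [simp]:
  "i < n \<Longrightarrow> p < \<alpha> i \<Longrightarrow> q < \<alpha> i \<Longrightarrow> to_End a i $$ (p, q) = coord i p q a"
  by (simp add: to_End_def)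

lemma to_End_carrier: "i < n \<Longrightarrow> to_End a i \<in> carrier_mat (\<alpha> i) (\<alpha> i)"
  by (simp add: to_End_def)

lemma to_End_bij: "bij_betw to_End UNIV (\<Pi>\<^sub>E i\<in>{..<n}. carrier_mat (\<alpha> i) (\<alpha> i))"
proof (rule bij_betw_imageI)
  show "inj to_End"
  proof (rule injI)
    fix a b assume "to_End a = to_End b"
    then have "coord i p q a = coord i p q b" if "i < n" "p < \<alpha> i" "q < \<alpha> i" for i p q
      using to_End_index that by metis
    then show "a = b"
      by (subst unit_expansion[of a], subst unit_expansion[of b]) simp
  qed
  show "range to_End = (\<Pi>\<^sub>E i\<in>{..<n}. carrier_mat (\<alpha> i) (\<alpha> i))"
  proof (intro equalityI subsetI)
    fix \<theta> assume "\<theta> \<in> range to_End"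
    then show "\<theta> \<in> (\<Pi>\<^sub>E i\<in>{..<n}. carrier_mat (\<alpha> i) (\<alpha> i))"
      by (auto simp: to_End_def)
  next
    fix \<theta> :: "nat \<Rightarrow> 'k mat"
    assume \<theta>: "\<theta> \<in> (\<Pi>\<^sub>E i\<in>{..<n}. carrier_mat (\<alpha> i) (\<alpha> i))"
    define a where "a = (\<Sum>j<n. \<Sum>s<\<alpha> j. \<Sum>t<\<alpha> j. scale (\<theta> j $$ (s, t)) (e j s t))"
    have coord_a: "coord i p q a = \<theta> i $$ (p, q)" if ipq: "i < n" "p < \<alpha> i" "q < \<alpha> i" for i p q
    proof -
      have "coord i p q a =
          (\<Sum>j<n. \<Sum>s<\<alpha> j. \<Sum>t<\<alpha> j. if i = j \<and> p = s \<and> q = t then \<theta> i $$ (p, q) else 0)"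
        unfolding a_def using ipq
        by (simp add: coord_sum coord_scale) (intro sum.cong refl, auto simp: coord_unit)
      also have "\<dots> = (\<Sum>j<n. if i = j then \<theta> i $$ (p, q) else 0)"
      proof (intro sum.cong refl)
        fix j
        have "(\<Sum>s<\<alpha> i. \<Sum>t<\<alpha> i. if p = s \<and> q = t then \<theta> i $$ (p, q) else 0) = \<theta> i $$ (p, q)"
          by (rule trans[OF double_sum_single[where p = p and q = q]])
             (use ipq in \<open>simp_all split: if_splits\<close>)
        then show "(\<Sum>s<\<alpha> j. \<Sum>t<\<alpha> j. if i = j \<and> p = s \<and> q = t then \<theta> i $$ (p, q) else 0) =
            (if i = j then \<theta> i $$ (p, q) else 0)"
          by auto
      qed
      also have "\<dots> = \<theta> i $$ (p, q)"
        using ipq by simp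
      finally show ?thesis .
    qed
    have "to_End a i = \<theta> i" for i
    proof (cases "i < n")
      case True
      have dims: "\<theta> i \<in> carrier_mat (\<alpha> i) (\<alpha> i)"
        by (rule PiE_mem[OF \<theta>]) (use True in simp)
      show ?thesis
      proof (rule eq_matI)
        fix p q assume "p < dim_row (\<theta> i)" "q < dim_col (\<theta> i)"
        then have "p < \<alpha> i" "q < \<alpha> i" unfolding carrier_matD[OF dims] .
        then show "to_End a i $$ (p, q) = \<theta> i $$ (p, q)"
          unfolding to_End_index[OF True \<open>p < \<alpha> i\<close> \<open>q < \<alpha> i\<close>] by (rule coord_a[OF True])
      qed (unfold carrier_matD[OF dims] carrier_matD[OF to_End_carrier[OF True]], rule refl, rule refl)
    next
      case False
      then show ?thesis using PiE_arb[OF \<theta>, of i] by (simp add: to_End_def)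
    qed
    then show "\<theta> \<in> range to_End" by (metis ext rangeI)
  qed
qed

theorem to_End_iso: "to_End \<in> algebra_iso (type_algebra scale) (End_alg {..<n} \<alpha>)"
proof -
  have "to_End (a * b) = (\<lambda>i\<in>{..<n}. to_End a i * to_End b i)" for a b
  proof (rule ext)
    fix i
    show "to_End (a * b) i = (\<lambda>i\<in>{..<n}. to_End a i * to_End b i) i"
      by (cases "i < n"; intro eq_matI)
         (auto simp: to_End_def coord_mult scalar_prod_def atLeast0LessThan)
  qed
  moreover have "to_End (a + b) = (\<lambda>i\<in>{..<n}. to_End a i + to_End b i)" for a b
    by (rule ext) (auto simp: to_End_def coord_add)
  moreover have "to_End 1 = (\<lambda>i\<in>{..<n}. 1\<^sub>m (\<alpha> i))"
    by (rule ext) (auto simp: to_End_def coord_one)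
  moreover have "to_End (scale c a) = (\<lambda>i\<in>{..<n}. c \<cdot>\<^sub>m to_End a i)" for c a
    by (rule ext) (auto simp: to_End_def coord_scale)
  moreover have "to_End a \<in> (\<Pi>\<^sub>E i\<in>{..<n}. carrier_mat (\<alpha> i) (\<alpha> i))" for a
    using to_End_carrier by (auto simp: to_End_def)
  ultimately show ?thesis
    using to_End_bij
    by (auto simp: algebra_iso_def ring_iso_def Ring.ring_hom_def type_algebra_def End_alg_def)
qed

text \<open>
  Since \<open>e i p q\<close> is the product of \<open>e i p 0\<close> and \<open>e i 0 q\<close>, exchanging these two factors shows that
  \<open>\<zeta>\<close> vanishes on off-diagonal units and is constant on the diagonal of a block.
\<close>

theorem quiver_trace_to_End:
  assumes lin: "Vector_Spaces.linear scale (*) \<zeta>" and tr: "\<And>a b. \<zeta> (a * b) = \<zeta> (b * a)"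
  shows "quiver_trace {..<n} (\<lambda>i. \<zeta> (e i 0 0)) (to_End a) = \<zeta> a"
proof -
  interpret \<zeta>: Vector_Spaces.linear scale "(*)" \<zeta> by (rule lin)
  have \<zeta>_unit: "\<zeta> (e i p q) = (if p = q then \<zeta> (e i 0 0) else 0)"
    if "i < n" "p < \<alpha> i" "q < \<alpha> i" for i p q
  proof -
    have "\<zeta> (e i p q) = \<zeta> (e i p 0 * e i 0 q)" using that by (simp add: unit_via_corner)
    also have "\<dots> = \<zeta> (e i 0 q * e i p 0)" by (rule tr)
    also have "\<dots> = (if p = q then \<zeta> (e i 0 0) else 0)"
      using that size_pos[of i] by (auto simp: unit_mult)
    finally show ?thesis .
  qed
  have "\<zeta> a = (\<Sum>i<n. \<Sum>p<\<alpha> i. \<Sum>q<\<alpha> i. coord i p q a * \<zeta> (e i p q))"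
    by (subst unit_expansion[of a]) (simp add: \<zeta>.sum \<zeta>.scale)
  also have "\<dots> = (\<Sum>i<n. \<Sum>p<\<alpha> i. \<Sum>q<\<alpha> i. if p = q then coord i p p a * \<zeta> (e i 0 0) else 0)"
  proof (intro sum.cong refl)
    fix i p q assume "i \<in> {..<n}" "p \<in> {..<\<alpha> i}" "q \<in> {..<\<alpha> i}"
    then show "coord i p q a * \<zeta> (e i p q) = (if p = q then coord i p p a * \<zeta> (e i 0 0) else 0)"
      using \<zeta>_unit[of i p q] by auto
  qed
  also have "\<dots> = (\<Sum>i<n. \<zeta> (e i 0 0) * (\<Sum>p<\<alpha> i. coord i p p a))"
    by (simp add: sum_distrib_left mult.commute)
  also have "\<dots> = quiver_trace {..<n} (\<lambda>i. \<zeta> (e i 0 0)) (to_End a)"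
    by (simp add: quiver_trace_def mat_trace_def diag_mat_def to_End_def
        interv_sum_list_conv_sum_set_nat atLeast0LessThan)
  finally show ?thesis ..
qed

end

section \<open>Homogeneous Darboux bases\<close>

lemma alternating_form_skew:
  fixes scale :: "'k::field \<Rightarrow> 'm::ab_group_add \<Rightarrow> 'm" and \<omega> :: "'m \<Rightarrow> 'm \<Rightarrow> 'k"
  assumes "bilinear_form scale \<omega>" "\<And>x. \<omega> x x = 0"
  shows "\<omega> y x = - \<omega> x y"
proof -
  interpret left: Vector_Spaces.linear scale "(*)" "\<lambda>w. \<omega> w z" for z
    using assms(1) by (simp add: bilinear_form_def)
  interpret right: Vector_Spaces.linear scale "(*)" "\<lambda>w. \<omega> z w" for z
    using assms(1) by (simp add: bilinear_form_def)
  have "0 = \<omega> (x + y) (x + y)" by (simp only: assms(2))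
  also have "\<dots> = \<omega> y x + \<omega> x y"
    by (simp add: left.add right.add assms(2)[of x] assms(2)[of y])
  finally show ?thesis by (simp add: eq_neg_iff_add_eq_0)
qed

text \<open>
  The only corners that \<open>\<omega>\<close> can pair nontrivially are \<open>V i j\<close> and \<open>V j i\<close>. The whole space may be
  larger than the sum of the \<open>V i j\<close>, and \<open>\<omega>\<close> need only be nondegenerate on the latter. The degrees
  \<open>(i, j)\<close> and \<open>(j, i)\<close> coincide when \<open>i = j\<close>; the arguments below do not distinguish this case.
\<close>

locale graded_symplectic_space = finite_dimensional_vector_space scale Basis
  for scale :: "'k::field \<Rightarrow> 'm::ab_group_add \<Rightarrow> 'm" and Basis :: "'m set" +
  fixes \<omega> :: "'m \<Rightarrow> 'm \<Rightarrow> 'k" and I :: "'i set" and V :: "'i \<Rightarrow> 'i \<Rightarrow> 'm set"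
  assumes bilinear: "bilinear_form scale \<omega>"
    and alternating: "\<omega> x x = 0"
    and subspace_V: "i \<in> I \<Longrightarrow> j \<in> I \<Longrightarrow> subspace (V i j)"
    and graded: "\<lbrakk>i \<in> I; j \<in> I; k \<in> I; m \<in> I; x \<in> V i j; y \<in> V k m; \<omega> x y \<noteq> 0\<rbrakk> \<Longrightarrow> k = j \<and> m = i"
    and nondegenerate: "\<lbrakk>i \<in> I; j \<in> I; x \<in> V i j; x \<noteq> 0\<rbrakk> \<Longrightarrow> \<exists>y\<in>V j i. \<omega> x y \<noteq> 0"
begin

sublocale form_right: Vector_Spaces.linear scale "(*)" "\<lambda>y. \<omega> x y" for x
  using bilinear by (simp add: bilinear_form_def)

sublocale form_left: Vector_Spaces.linear scale "(*)" "\<lambda>x. \<omega> x y" for y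
  using bilinear by (simp add: bilinear_form_def)

lemma skew: "\<omega> y x = - \<omega> x y"
  using alternating_form_skew[OF bilinear alternating] .

text \<open>
  The degree \<open>(dst a, src a)\<close> of \<open>u a\<close> anticipates the arrow \<open>a\<close> from \<open>src a\<close> to \<open>dst a\<close>, and the
  opposite degree of \<open>v a\<close> its reverse.
\<close>

definition homogeneous_darboux ::
  "nat \<Rightarrow> (nat \<Rightarrow> 'i) \<Rightarrow> (nat \<Rightarrow> 'i) \<Rightarrow> (nat \<Rightarrow> 'm) \<Rightarrow> (nat \<Rightarrow> 'm) \<Rightarrow> bool" where
  "homogeneous_darboux N dst src u v \<longleftrightarrow>
     (\<forall>a<N. dst a \<in> I \<and> src a \<in> I \<and> u a \<in> V (dst a) (src a) \<and> v a \<in> V (src a) (dst a)) \<and>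
     (\<forall>a<N. \<forall>b<N. \<omega> (u a) (u b) = 0 \<and> \<omega> (v a) (v b) = 0 \<and> \<omega> (v a) (u b) = (if a = b then 1 else 0))"

text \<open>
  The projection onto the span of the pairs along its orthogonal complement.
\<close>

definition darboux_part :: "nat \<Rightarrow> (nat \<Rightarrow> 'm) \<Rightarrow> (nat \<Rightarrow> 'm) \<Rightarrow> 'm \<Rightarrow> 'm" where
  "darboux_part N u v x = (\<Sum>a<N. scale (\<omega> (v a) x) (u a) - scale (\<omega> (u a) x) (v a))"

text \<open>
  The vectors \<open>u a\<close> are linearly independent, because pairing with \<open>v b\<close> isolates the coefficient of
  \<open>u b\<close> in a relation.
\<close>

lemma homogeneous_darboux_bound:
  assumes "homogeneous_darboux N dst src u v"
  shows "N \<le> dimension"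
proof (rule ccontr)
  assume "\<not> N \<le> dimension"
  then obtain c b where c: "(\<Sum>a<N. scale (c a) (u a)) = 0" "b < N" "c b \<noteq> 0"
    using nontrivial_relation[of "{..<N}" u] by auto
  have "0 = \<omega> (v b) (\<Sum>a<N. scale (c a) (u a))"
    using c(1) by simp
  also have "\<dots> = (\<Sum>a<N. if b = a then c a else 0)"
    unfolding form_right.sum
    by (rule sum.cong) (use assms c(2) in \<open>auto simp: homogeneous_darboux_def form_right.scale\<close>)
  also have "\<dots> = c b" using c(2) by simp
  finally show False using c(3) by simp
qed

text \<open>
  A pair contributes \<open>u a\<close> only if \<open>\<omega> (v a) x \<noteq> 0\<close>, and then \<open>u a\<close> has the same degree as \<open>x\<close>;
  likewise for \<open>v a\<close>.
\<close>

lemma darboux_part_homogeneous: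
  assumes D: "homogeneous_darboux N dst src u v" and ij: "i \<in> I" "j \<in> I" and x: "x \<in> V i j"
  shows "darboux_part N u v x \<in> V i j"
proof -
  have D': "dst a \<in> I" "src a \<in> I" "u a \<in> V (dst a) (src a)" "v a \<in> V (src a) (dst a)" if "a < N" for a
    using D that by (auto simp: homogeneous_darboux_def)
  have "scale (\<omega> (v a) x) (u a) \<in> V i j" if a: "a < N" for a
  proof (cases "\<omega> (v a) x = 0")
    case True
    then show ?thesis using subspace_0[OF subspace_V[OF ij]] by simp
  next
    case False
    then have "i = dst a \<and> j = src a"
      using graded[OF D'(2,1)[OF a] ij D'(4)[OF a] x] by blast
    then show ?thesis
      using subspace_scale[OF subspace_V[OF ij]] D'(3)[OF a] by simp
  qed
  moreover have "scale (\<omega> (u a) x) (v a) \<in> V i j" if a: "a < N" for a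
  proof (cases "\<omega> (u a) x = 0")
    case True
    then show ?thesis using subspace_0[OF subspace_V[OF ij]] by simp
  next
    case False
    then have "i = src a \<and> j = dst a"
      using graded[OF D'(1,2)[OF a] ij D'(3)[OF a] x] by blast
    then show ?thesis
      using subspace_scale[OF subspace_V[OF ij]] D'(4)[OF a] by simp
  qed
  ultimately show ?thesis
    unfolding darboux_part_def
    by (intro subspace_sum[OF subspace_V[OF ij]] subspace_diff[OF subspace_V[OF ij]]) auto
qed

lemma orthogonal_to_darboux:
  assumes D: "homogeneous_darboux N dst src u v" and b: "b < N"
  shows "\<omega> (u b) (x - darboux_part N u v x) = 0" "\<omega> (v b) (x - darboux_part N u v x) = 0"
proof -
  have D': "\<omega> (u a) (u b) = 0" "\<omega> (v a) (v b) = 0" "\<omega> (v a) (u b) = (if a = b then 1 else 0)"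
    "\<omega> (u b) (v a) = (if a = b then - 1 else 0)"
    if "a < N" "b < N" for a b
    using D that skew[of "u b" "v a"] by (auto simp: homogeneous_darboux_def)
  have "\<omega> (u b) (darboux_part N u v x) = (\<Sum>a<N. if b = a then \<omega> (u a) x else 0)"
    unfolding darboux_part_def form_right.sum
    by (rule sum.cong) (use b in \<open>auto simp: D' form_right.diff form_right.scale\<close>)
  then show "\<omega> (u b) (x - darboux_part N u v x) = 0"
    using b by (simp add: form_right.diff)
  have "\<omega> (v b) (darboux_part N u v x) = (\<Sum>a<N. if b = a then \<omega> (v a) x else 0)"
    unfolding darboux_part_def form_right.sum
    by (rule sum.cong) (use b in \<open>auto simp: D' form_right.diff form_right.scale\<close>)
  then show "\<omega> (v b) (x - darboux_part N u v x) = 0"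
    using b by (simp add: form_right.diff)
qed

text \<open>
  A longest family of pairs spans. Otherwise some homogeneous \<open>x\<close> differs from its projection, the
  difference \<open>x'\<close> is homogeneous, nonzero and orthogonal to all pairs. A homogeneous \<open>y\<close> with
  \<open>\<omega> x' y \<noteq> 0\<close>, made orthogonal to the pairs in the same way and rescaled, completes \<open>x'\<close> to one
  more pair.
\<close>

theorem exists_homogeneous_darboux_basis:
  "\<exists>N dst src u v. homogeneous_darboux N dst src u v \<and>
     (\<forall>i\<in>I. \<forall>j\<in>I. \<forall>x\<in>V i j. darboux_part N u v x = x)"
proof -
  let ?P = "\<lambda>N. \<exists>dst src u v. homogeneous_darboux N dst src u v"
  have "?P 0" by (simp add: homogeneous_darboux_def)
  then have "\<exists>N. ?P N \<and> (\<forall>M. ?P M \<longrightarrow> M \<le> N)"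
    using GreatestI_nat[of ?P 0 dimension] Greatest_le_nat[of ?P _ dimension]
      homogeneous_darboux_bound by blast
  then obtain N dst src u v where D: "homogeneous_darboux N dst src u v"
    and max: "\<And>M. ?P M \<Longrightarrow> M \<le> N" by blast
  have "darboux_part N u v x = x" if ij: "i \<in> I" "j \<in> I" and x: "x \<in> V i j" for i j x
  proof (rule ccontr)
    assume ne: "darboux_part N u v x \<noteq> x"
    define x' where "x' = x - darboux_part N u v x"
    have x': "x' \<in> V i j" "x' \<noteq> 0"
      unfolding x'_def
      using ne subspace_diff[OF subspace_V[OF ij] x darboux_part_homogeneous[OF D ij x]] by auto
    have ox': "\<omega> (u b) x' = 0" "\<omega> (v b) x' = 0" if "b < N" for b
      using orthogonal_to_darboux[OF D that] by (auto simp: x'_def)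
    obtain y where y: "y \<in> V j i" "\<omega> x' y \<noteq> 0"
      using nondegenerate[OF ij x'] by blast
    define y' where "y' = y - darboux_part N u v y"
    have y': "y' \<in> V j i"
      unfolding y'_def
      using subspace_diff[OF subspace_V[OF ij(2,1)] y(1) darboux_part_homogeneous[OF D ij(2,1) y(1)]] .
    have oy': "\<omega> (u b) y' = 0" "\<omega> (v b) y' = 0" if "b < N" for b
      using orthogonal_to_darboux[OF D that] by (auto simp: y'_def)
    \<comment> \<open>Projecting \<open>y\<close> away from the pairs does not change its value against \<open>x'\<close>.\<close>
    have "\<omega> x' (darboux_part N u v y) = (\<Sum>a<N. 0)"
      unfolding darboux_part_def form_right.sum
      by (rule sum.cong) (auto simp: form_right.diff form_right.scale ox' skew[of x' "u _"] skew[of x' "v _"])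
    then have "\<omega> x' y' \<noteq> 0" using y(2) by (simp add: y'_def form_right.diff)
    then have yx: "\<omega> y' x' \<noteq> 0" using skew[of y' x'] by simp
    define y'' where "y'' = scale (inverse (\<omega> y' x')) y'"
    have y'': "y'' \<in> V j i" "\<omega> y'' x' = 1"
      using subspace_scale[OF subspace_V[OF ij(2,1)] y'] yx
      by (auto simp: y''_def form_left.scale)
    have oy'': "\<omega> (u b) y'' = 0" "\<omega> (v b) y'' = 0" if "b < N" for b
      using oy'[OF that] by (auto simp: y''_def form_right.scale)
    have ox'_left: "\<omega> x' (u b) = 0" if "b < N" for b
      using ox'(1)[OF that] skew[of x' "u b"] by simp
    have oy''_left: "\<omega> y'' (u b) = 0" if "b < N" for b
      using oy''(1)[OF that] skew[of y'' "u b"] by simp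
    have oy''_left': "\<omega> y'' (v b) = 0" if "b < N" for b
      using oy''(2)[OF that] skew[of y'' "v b"] by simp
    have "homogeneous_darboux (Suc N) (dst(N := i)) (src(N := j)) (u(N := x')) (v(N := y''))"
      using D ij x'(1) y'' alternating
      unfolding homogeneous_darboux_def by (auto simp: less_Suc_eq ox' oy'' ox'_left oy''_left oy''_left')
    then show False using max[of "Suc N"] by auto
  qed
  with D show ?thesis by blast
qed

end

section \<open>Bimodules in block coordinates\<close>

locale bimodule_over_matrix_units =
  k_bimodule scaleA scaleM l r + matrix_units scaleA n \<alpha> e
  for scaleA :: "'k::field \<Rightarrow> 'a::{ring, monoid_mult} \<Rightarrow> 'a"
    and scaleM :: "'k \<Rightarrow> 'm::ab_group_add \<Rightarrow> 'm"
    and l :: "'a \<Rightarrow> 'm \<Rightarrow> 'm" and r :: "'m \<Rightarrow> 'a \<Rightarrow> 'm"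
    and n :: nat and \<alpha> :: "nat \<Rightarrow> nat" and e :: "nat \<Rightarrow> nat \<Rightarrow> nat \<Rightarrow> 'a"
begin

lemma l_zero: "l a 0 = 0"
  using l_add[of a 0 0] by simp

lemma l_zero_alg: "l 0 x = 0"
  using l_add_alg[of 0 0 x] by simp

lemma r_zero: "r 0 a = 0"
  using r_add[of 0 0 a] by simp

lemma r_zero_alg: "r x 0 = 0"
  using r_add_alg[of x 0 0] by simp

lemma l_sum: "l a (\<Sum>x\<in>X. f x) = (\<Sum>x\<in>X. l a (f x))"
  by (induction X rule: infinite_finite_induct) (simp_all add: l_zero l_add)

lemma l_sum_alg: "l (\<Sum>a\<in>X. f a) x = (\<Sum>a\<in>X. l (f a) x)"
  by (induction X rule: infinite_finite_induct) (simp_all add: l_zero_alg l_add_alg)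

lemma r_sum: "r (\<Sum>x\<in>X. f x) a = (\<Sum>x\<in>X. r (f x) a)"
  by (induction X rule: infinite_finite_induct) (simp_all add: r_zero r_add)

lemma r_sum_alg: "r x (\<Sum>a\<in>X. f a) = (\<Sum>a\<in>X. r x (f a))"
  by (induction X rule: infinite_finite_induct) (simp_all add: r_zero_alg r_add_alg)

definition corner :: "nat \<Rightarrow> nat \<Rightarrow> 'm set" where
  "corner i j = {x. l (e i 0 0) (r x (e j 0 0)) = x}"

text \<open>
  The entry in row \<open>p\<close> and column \<open>q\<close> of the block \<open>(i, j)\<close> of \<open>x\<close>, moved into the corner \<open>(i, j)\<close>.
\<close>

definition block_entry :: "nat \<Rightarrow> nat \<Rightarrow> nat \<Rightarrow> nat \<Rightarrow> 'm \<Rightarrow> 'm" where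
  "block_entry i p j q x = l (e i 0 p) (r x (e j q 0))"

lemma corner_left:
  assumes "i < n" "x \<in> corner i j"
  shows "l (e i 0 0) x = x"
proof -
  have "l (e i 0 0) x = l (e i 0 0 * e i 0 0) (r x (e j 0 0))"
    using assms(2) unfolding l_mult by (simp add: corner_def)
  then show ?thesis using assms size_pos[of i] by (simp add: unit_mult corner_def)
qed

lemma corner_right:
  assumes "j < n" "x \<in> corner i j"
  shows "r x (e j 0 0) = x"
proof -
  have "r x (e j 0 0) = l (e i 0 0) (r x (e j 0 0 * e j 0 0))"
    using assms(2) unfolding r_mult l_r_assoc[symmetric] by (simp add: corner_def l_r_assoc)
  then show ?thesis using assms size_pos[of j] by (simp add: unit_mult corner_def)
qed

lemma corner_subspace: "vs.subspace (corner i j)"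
  unfolding vs.subspace_def corner_def
  by (auto simp: l_zero r_zero l_add r_add l_scale r_scale)

lemma block_entry_corner:
  assumes "i < n" "j < n" "p < \<alpha> i" "q < \<alpha> j"
  shows "block_entry i p j q x \<in> corner i j"
proof -
  have "l (e i 0 0) (r (block_entry i p j q x) (e j 0 0)) =
      l (e i 0 0 * e i 0 p) (r x (e j q 0 * e j 0 0))"
    by (simp only: block_entry_def l_r_assoc l_mult r_mult)
  then show ?thesis
    using assms size_pos by (simp add: corner_def unit_mult block_entry_def)
qed

lemma block_entry_add: "block_entry i p j q (x + y) = block_entry i p j q x + block_entry i p j q y"
  by (simp add: block_entry_def l_add r_add)

lemma block_entry_scale: "block_entry i p j q (scaleM c x) = scaleM c (block_entry i p j q x)"
  by (simp add: block_entry_def l_scale r_scale)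

lemma block_entry_sum: "block_entry i p j q (\<Sum>x\<in>X. f x) = (\<Sum>x\<in>X. block_entry i p j q (f x))"
  by (simp add: block_entry_def l_sum r_sum)

lemma block_entry_l:
  assumes "i < n" "p < \<alpha> i"
  shows "block_entry i p j q (l a x) = (\<Sum>s<\<alpha> i. scaleM (coord i p s a) (block_entry i s j q x))"
proof -
  have "block_entry i p j q (l a x) = l (e i 0 p * a) (r x (e j q 0))"
    by (simp only: block_entry_def l_r_assoc l_mult)
  then show ?thesis
    using assms by (simp add: row_expansion l_sum_alg l_scale_alg block_entry_def)
qed

lemma block_entry_r:
  assumes "j < n" "q < \<alpha> j"
  shows "block_entry i p j q (r x a) = (\<Sum>s<\<alpha> j. scaleM (coord j s q a) (block_entry i p j s x))"
proof -
  have "block_entry i p j q (r x a) = l (e i 0 p) (r x (a * e j q 0))"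
    by (simp only: block_entry_def r_mult)
  then show ?thesis
    using assms by (simp add: column_expansion r_sum_alg r_scale_alg l_sum l_scale block_entry_def)
qed

text \<open>
  Expand the two outer factors of \<open>x = 1x1\<close> into diagonal units, and each of those through
  position \<open>0\<close>.
\<close>

lemma block_expansion:
  "x = (\<Sum>i<n. \<Sum>j<n. \<Sum>p<\<alpha> i. \<Sum>q<\<alpha> j. l (e i p 0) (r (block_entry i p j q x) (e j 0 q)))"
proof -
  have *: "l (e i p 0) (r (block_entry i p j q x) (e j 0 q)) = l (e i p p) (r x (e j q q))"
    if "i < n" "j < n" "p < \<alpha> i" "q < \<alpha> j" for i j p q
  proof -
    have "l (e i p 0) (r (block_entry i p j q x) (e j 0 q)) =
        l (e i p 0 * e i 0 p) (r x (e j q 0 * e j 0 q))"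
      by (simp only: block_entry_def l_r_assoc l_mult r_mult)
    then show ?thesis using that by (simp add: unit_via_corner)
  qed
  have "x = l (\<Sum>i<n. \<Sum>p<\<alpha> i. e i p p) (r x (\<Sum>j<n. \<Sum>q<\<alpha> j. e j q q))"
    by (simp add: sum_diag l_one r_one)
  also have "\<dots> = (\<Sum>i<n. \<Sum>p<\<alpha> i. l (e i p p) (r x (\<Sum>j<n. \<Sum>q<\<alpha> j. e j q q)))"
    by (simp only: l_sum_alg)
  also have "\<dots> = (\<Sum>i<n. \<Sum>p<\<alpha> i. \<Sum>j<n. \<Sum>q<\<alpha> j. l (e i p p) (r x (e j q q)))"
    by (simp only: r_sum_alg l_sum)
  also have "\<dots> = (\<Sum>i<n. \<Sum>j<n. \<Sum>p<\<alpha> i. \<Sum>q<\<alpha> j. l (e i p p) (r x (e j q q)))"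
    by (intro sum.cong refl sum.swap)
  also have "\<dots> = (\<Sum>i<n. \<Sum>j<n. \<Sum>p<\<alpha> i. \<Sum>q<\<alpha> j. l (e i p 0) (r (block_entry i p j q x) (e j 0 q)))"
    by (simp add: *)
  finally show ?thesis .
qed

lemma block_entry_unit:
  assumes "i < n" "j < n" "p < \<alpha> i" "q < \<alpha> j" "i' < n" "j' < n" "s < \<alpha> i'" "t < \<alpha> j'"
    and "x \<in> corner i' j'"
  shows "block_entry i p j q (l (e i' s 0) (r x (e j' 0 t))) =
    (if i = i' \<and> j = j' \<and> p = s \<and> q = t then x else 0)"
proof -
  have "block_entry i p j q (l (e i' s 0) (r x (e j' 0 t))) =
      l (e i 0 p * e i' s 0) (r x (e j' 0 t * e j q 0))"
    by (simp only: block_entry_def l_r_assoc l_mult r_mult)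
  then show ?thesis
    using assms size_pos corner_def
    by (auto simp: unit_mult l_zero l_zero_alg r_zero_alg corner_def)
qed

end

text \<open>
  A basis of the sum of the corners that is indexed by the arcs of \<open>G\<close>, the degree of a basis vector
  being given by the ends of its arc, together with the dual functionals. These are part of the data
  because for a Darboux basis the form provides them explicitly.
\<close>

locale homogeneous_basis = bimodule_over_matrix_units scaleA scaleM l r n \<alpha> e
  for scaleA :: "'k::field \<Rightarrow> 'a::{ring, monoid_mult} \<Rightarrow> 'a"
    and scaleM :: "'k \<Rightarrow> 'm::ab_group_add \<Rightarrow> 'm"
    and l :: "'a \<Rightarrow> 'm \<Rightarrow> 'm" and r :: "'m \<Rightarrow> 'a \<Rightarrow> 'm"
    and n :: nat and \<alpha> :: "nat \<Rightarrow> nat" and e :: "nat \<Rightarrow> nat \<Rightarrow> nat \<Rightarrow> 'a" +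
  fixes G :: "(nat, 'e) pre_digraph" and d :: "'e \<Rightarrow> 'm" and \<phi> :: "'e \<Rightarrow> 'm \<Rightarrow> 'k"
  assumes finite_arcs: "finite (arcs G)"
    and head_lt: "b \<in> arcs G \<Longrightarrow> head G b < n" and tail_lt: "b \<in> arcs G \<Longrightarrow> tail G b < n"
    and basis_corner: "b \<in> arcs G \<Longrightarrow> d b \<in> corner (head G b) (tail G b)"
    and dual_linear: "b \<in> arcs G \<Longrightarrow> Vector_Spaces.linear scaleM (*) (\<phi> b)"
    and dual_basis: "b \<in> arcs G \<Longrightarrow> c \<in> arcs G \<Longrightarrow> \<phi> b (d c) = (if b = c then 1 else 0)"
    and dual_homogeneous: "\<lbrakk>b \<in> arcs G; i < n; j < n; x \<in> corner i j; \<phi> b x \<noteq> 0\<rbrakk> \<Longrightarrow>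
      head G b = i \<and> tail G b = j"
    and basis_expansion: "\<lbrakk>i < n; j < n; x \<in> corner i j\<rbrakk> \<Longrightarrow>
      x = (\<Sum>b\<in>arcs G. scaleM (\<phi> b x) (d b))"
begin

definition to_Rep :: "'m \<Rightarrow> 'e \<Rightarrow> 'k mat" where
  "to_Rep x = (\<lambda>b\<in>arcs G. mat (\<alpha> (head G b)) (\<alpha> (tail G b))
     (\<lambda>(p, q). \<phi> b (block_entry (head G b) p (tail G b) q x)))"

lemma to_Rep_index [simp]:
  "\<lbrakk>b \<in> arcs G; p < \<alpha> (head G b); q < \<alpha> (tail G b)\<rbrakk> \<Longrightarrow>
    to_Rep x b $$ (p, q) = \<phi> b (block_entry (head G b) p (tail G b) q x)"
  by (simp add: to_Rep_def)

lemma to_Rep_carrier: "b \<in> arcs G \<Longrightarrow> to_Rep x b \<in> carrier_mat (\<alpha> (head G b)) (\<alpha> (tail G b))"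
  by (simp add: to_Rep_def)

text \<open>
  The matrix of an arc \<open>b\<close> records the coefficient at \<open>d b\<close> only for the block whose degree is that
  of \<open>b\<close>. In every other block this coefficient vanishes, so all entries of \<open>x\<close> are determined.
\<close>

lemma to_Rep_inj: "inj to_Rep"
proof (rule injI)
  fix x y assume eq: "to_Rep x = to_Rep y"
  have "block_entry i p j q x = block_entry i p j q y"
    if ij: "i < n" "j < n" "p < \<alpha> i" "q < \<alpha> j" for i p j q
  proof -
    have "\<phi> b (block_entry i p j q x) = \<phi> b (block_entry i p j q y)" if b: "b \<in> arcs G" for b
    proof (cases "head G b = i \<and> tail G b = j")
      case True
      then show ?thesis
        using ij b to_Rep_index[of b p q x] to_Rep_index[of b p q y] eq by auto
    next
      case False
      then show ?thesis
        using dual_homogeneous[OF b ij(1,2) block_entry_corner[OF ij]] by metis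
    qed
    then have "(\<Sum>b\<in>arcs G. scaleM (\<phi> b (block_entry i p j q x)) (d b)) =
        (\<Sum>b\<in>arcs G. scaleM (\<phi> b (block_entry i p j q y)) (d b))"
      by simp
    then show ?thesis
      using basis_expansion[OF ij(1,2) block_entry_corner[OF ij]] by metis
  qed
  then show "x = y"
    by (subst block_expansion[of x], subst block_expansion[of y]) simp
qed

text \<open>
  A preimage of \<open>y\<close> is obtained by putting the multiple \<open>y c $$ (s, t)\<close> of \<open>d c\<close> into row \<open>s\<close> and
  column \<open>t\<close> of the block to which \<open>c\<close> belongs.
\<close>

lemma to_Rep_surj:
  assumes y: "y \<in> (\<Pi>\<^sub>E b\<in>arcs G. carrier_mat (\<alpha> (head G b)) (\<alpha> (tail G b)))"
  shows "y \<in> range to_Rep"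
proof -
  define x where "x = (\<Sum>c\<in>arcs G. \<Sum>s<\<alpha> (head G c). \<Sum>t<\<alpha> (tail G c).
    scaleM (y c $$ (s, t)) (l (e (head G c) s 0) (r (d c) (e (tail G c) 0 t))))"
  have *: "\<phi> b (block_entry (head G b) p (tail G b) q x) = y b $$ (p, q)"
    if b: "b \<in> arcs G" "p < \<alpha> (head G b)" "q < \<alpha> (tail G b)" for b p q
  proof -
    interpret \<phi>: Vector_Spaces.linear scaleM "(*)" "\<phi> b" by (rule dual_linear[OF b(1)])
    have "\<phi> b (block_entry (head G b) p (tail G b) q x) =
        (\<Sum>c\<in>arcs G. \<Sum>s<\<alpha> (head G c). \<Sum>t<\<alpha> (tail G c). y c $$ (s, t) *
          \<phi> b (block_entry (head G b) p (tail G b) q (l (e (head G c) s 0) (r (d c) (e (tail G c) 0 t)))))"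
      unfolding x_def by (simp add: block_entry_sum block_entry_scale \<phi>.sum \<phi>.scale)
    also have "\<dots> = (\<Sum>c\<in>arcs G. if b = c then y b $$ (p, q) else 0)"
    proof (rule sum.cong[OF refl])
      fix c assume c: "c \<in> arcs G"
      have entry: "\<phi> b (block_entry (head G b) p (tail G b) q
          (l (e (head G c) s 0) (r (d c) (e (tail G c) 0 t)))) = (if b = c \<and> s = p \<and> t = q then 1 else 0)"
        if "s < \<alpha> (head G c)" "t < \<alpha> (tail G c)" for s t
        using block_entry_unit[OF head_lt[OF b(1)] tail_lt[OF b(1)] b(2,3) head_lt[OF c] tail_lt[OF c] that
            basis_corner[OF c]] dual_basis[OF b(1) c] by auto
      have "(\<Sum>s<\<alpha> (head G c). \<Sum>t<\<alpha> (tail G c). y c $$ (s, t) *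
          \<phi> b (block_entry (head G b) p (tail G b) q (l (e (head G c) s 0) (r (d c) (e (tail G c) 0 t))))) =
          (\<Sum>s<\<alpha> (head G c). \<Sum>t<\<alpha> (tail G c). y c $$ (s, t) * (if b = c \<and> s = p \<and> t = q then 1 else 0))"
        by (intro sum.cong refl) (simp only: entry lessThan_iff)
      also have "\<dots> = (if b = c then y b $$ (p, q) else 0)"
      proof (cases "b = c")
        case True
        show ?thesis
          by (rule trans[OF double_sum_single[where p = p and q = q]])
             (use True b in \<open>simp_all split: if_splits\<close>)
      qed simp
      finally show "(\<Sum>s<\<alpha> (head G c). \<Sum>t<\<alpha> (tail G c). y c $$ (s, t) *
          \<phi> b (block_entry (head G b) p (tail G b) q (l (e (head G c) s 0) (r (d c) (e (tail G c) 0 t))))) =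
          (if b = c then y b $$ (p, q) else 0)" .
    qed
    also have "\<dots> = y b $$ (p, q)"
      using b(1) finite_arcs by simp
    finally show ?thesis .
  qed
  have "to_Rep x b = y b" for b
  proof (cases "b \<in> arcs G")
    case True
    have dims: "y b \<in> carrier_mat (\<alpha> (head G b)) (\<alpha> (tail G b))"
      by (rule PiE_mem[OF y True])
    show ?thesis
    proof (rule eq_matI)
      fix p q assume "p < dim_row (y b)" "q < dim_col (y b)"
      then have pq: "p < \<alpha> (head G b)" "q < \<alpha> (tail G b)" unfolding carrier_matD[OF dims] .
      show "to_Rep x b $$ (p, q) = y b $$ (p, q)"
        unfolding to_Rep_index[OF True pq] by (rule *[OF True pq])
    qed (unfold carrier_matD[OF dims] carrier_matD[OF to_Rep_carrier[OF True]], rule refl, rule refl)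
  next
    case False
    then show ?thesis using PiE_arb[OF y, of b] by (simp add: to_Rep_def)
  qed
  then show ?thesis by (metis ext rangeI)
qed

theorem to_Rep_iso:
  "to_Rep \<in> bimodule_iso (type_algebra scaleA) (type_bimodule scaleM l r) (twist to_End (Rep_bimod G \<alpha>))"
proof -
  have lin: "\<phi> b (x + y) = \<phi> b x + \<phi> b y" "\<phi> b (scaleM c x) = c * \<phi> b x"
    "\<phi> b (\<Sum>s\<in>X. f s) = (\<Sum>s\<in>X. \<phi> b (f s))" if "b \<in> arcs G" for b x y c and f :: "nat \<Rightarrow> 'm" and X
  proof -
    interpret \<phi>: Vector_Spaces.linear scaleM "(*)" "\<phi> b" by (rule dual_linear[OF that])
    show "\<phi> b (x + y) = \<phi> b x + \<phi> b y" "\<phi> b (scaleM c x) = c * \<phi> b x"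
      "\<phi> b (\<Sum>s\<in>X. f s) = (\<Sum>s\<in>X. \<phi> b (f s))"
      by (simp_all add: \<phi>.add \<phi>.scale \<phi>.sum)
  qed
  have "to_Rep (x + y) = (\<lambda>b\<in>arcs G. to_Rep x b + to_Rep y b)" for x y
    by (rule ext) (auto simp: to_Rep_def block_entry_add lin)
  moreover have "to_Rep (scaleM c x) = (\<lambda>b\<in>arcs G. c \<cdot>\<^sub>m to_Rep x b)" for c x
    by (rule ext) (auto simp: to_Rep_def block_entry_scale lin)
  moreover have "to_Rep (l a x) = (\<lambda>b\<in>arcs G. to_End a (head G b) * to_Rep x b)" for a x
  proof (rule ext)
    fix b
    show "to_Rep (l a x) b = (\<lambda>b\<in>arcs G. to_End a (head G b) * to_Rep x b) b"
      by (cases "b \<in> arcs G"; intro eq_matI)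
         (auto simp: to_Rep_def to_End_def head_lt tail_lt block_entry_l lin scalar_prod_def atLeast0LessThan)
  qed
  moreover have "to_Rep (r x a) = (\<lambda>b\<in>arcs G. to_Rep x b * to_End a (tail G b))" for a x
  proof (rule ext)
    fix b
    show "to_Rep (r x a) b = (\<lambda>b\<in>arcs G. to_Rep x b * to_End a (tail G b)) b"
      by (cases "b \<in> arcs G"; intro eq_matI)
         (auto simp: to_Rep_def to_End_def head_lt tail_lt block_entry_r lin scalar_prod_def
           atLeast0LessThan mult.commute)
  qed
  moreover have "bij_betw to_Rep UNIV (\<Pi>\<^sub>E b\<in>arcs G. carrier_mat (\<alpha> (head G b)) (\<alpha> (tail G b)))"
  proof (rule bij_betw_imageI[OF to_Rep_inj])
    have "to_Rep x \<in> (\<Pi>\<^sub>E b\<in>arcs G. carrier_mat (\<alpha> (head G b)) (\<alpha> (tail G b)))" for x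
      using to_Rep_carrier by (auto simp: to_Rep_def)
    with to_Rep_surj show "range to_Rep = (\<Pi>\<^sub>E b\<in>arcs G. carrier_mat (\<alpha> (head G b)) (\<alpha> (tail G b)))"
      by blast
  qed
  ultimately show ?thesis
    by (simp add: bimodule_iso_def type_algebra_def type_bimodule_def twist_def Rep_bimod_def)
qed

end

section \<open>The symplectic form in block coordinates\<close>

locale symplectic_bimodule_over_matrix_units =
  bimodule_over_matrix_units scaleA scaleM l r n \<alpha> e
  for scaleA :: "'k::field \<Rightarrow> 'a::{ring, monoid_mult} \<Rightarrow> 'a"
    and scaleM :: "'k \<Rightarrow> 'm::ab_group_add \<Rightarrow> 'm"
    and l :: "'a \<Rightarrow> 'm \<Rightarrow> 'm" and r :: "'m \<Rightarrow> 'a \<Rightarrow> 'm"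
    and n :: nat and \<alpha> :: "nat \<Rightarrow> nat" and e :: "nat \<Rightarrow> nat \<Rightarrow> nat \<Rightarrow> 'a" +
  fixes \<omega> :: "'m \<Rightarrow> 'm \<Rightarrow> 'k"
  assumes symplectic: "symplectic_form scaleM \<omega>"
    and balanced: "balanced l r \<omega>"
begin

lemma bilinear: "bilinear_form scaleM \<omega>"
  and alternating: "\<omega> x x = 0"
  and nondegenerate: "x \<noteq> 0 \<Longrightarrow> \<exists>y. \<omega> x y \<noteq> 0"
  using symplectic by (auto simp: symplectic_form_def)

sublocale form_right: Vector_Spaces.linear scaleM "(*)" "\<lambda>y. \<omega> x y" for x
  using bilinear by (simp add: bilinear_form_def)

sublocale form_left: Vector_Spaces.linear scaleM "(*)" "\<lambda>x. \<omega> x y" for y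
  using bilinear by (simp add: bilinear_form_def)

lemma skew: "\<omega> y x = - \<omega> x y"
  using alternating_form_skew[OF bilinear alternating] .

lemma move_right_to_left: "\<omega> (r x a) y = \<omega> x (l a y)"
  using balanced by (simp add: balanced_def)

text \<open>
  Antisymmetry converts the balancing condition, which exchanges a right action on the first argument
  for a left action on the second, into its mirror image.
\<close>

lemma move_left_to_right: "\<omega> (l a x) y = \<omega> x (r y a)"
proof -
  have "\<omega> (l a x) y = - \<omega> y (l a x)" by (rule skew)
  also have "\<dots> = - \<omega> (r y a) x" by (simp only: move_right_to_left)
  also have "\<dots> = \<omega> x (r y a)" by (rule skew[symmetric])
  finally show ?thesis .
qed

text \<open>
  For \<open>x \<in> e\<^sub>iMe\<^sub>j\<close> and \<open>y \<in> e\<^sub>kMe\<^sub>m\<close>, moving idempotents across the form gives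
  \<open>\<omega>(x, y) = \<omega>(x, e\<^sub>je\<^sub>ky) = \<omega>(x, ye\<^sub>me\<^sub>i)\<close>, which vanishes unless \<open>j = k\<close> and \<open>m = i\<close>. In the same way
  \<open>\<omega>(x, y) = \<omega>(x, e\<^sub>jye\<^sub>i)\<close> for every \<open>y\<close>, so nondegeneracy is inherited by the corners.
\<close>

lemma graded_corners:
  assumes "finite_dimensional_vector_space scaleM B"
  shows "graded_symplectic_space scaleM B \<omega> {..<n} corner"
proof -
  interpret finite_dimensional_vector_space scaleM B by (rule assms)
  show ?thesis
  proof (unfold_locales, goal_cases)
    case 1
    show ?case by (rule bilinear)
  next
    case (2 x)
    show ?case by (rule alternating)
  next
    case (3 i j)
    show ?case by (rule corner_subspace)
  next
    case (4 i j k m x y)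
    have "\<omega> x y = \<omega> (r x (e j 0 0)) (l (e k 0 0) y)"
      using 4 by (simp add: corner_left corner_right)
    also have "\<dots> = \<omega> x (l (e j 0 0 * e k 0 0) y)"
      by (simp only: move_right_to_left l_mult)
    finally have "k = j"
      using 4 size_pos by (auto simp: unit_mult l_zero_alg form_right.zero split: if_splits)
    have "\<omega> x y = \<omega> (l (e i 0 0) x) (r y (e m 0 0))"
      using 4 by (simp add: corner_left corner_right)
    also have "\<dots> = \<omega> x (r y (e m 0 0 * e i 0 0))"
      by (simp only: move_left_to_right r_mult)
    finally have "m = i"
      using 4 size_pos by (auto simp: unit_mult r_zero_alg form_right.zero split: if_splits)
    with \<open>k = j\<close> show ?case ..
  next
    case (5 i j x)
    then obtain y where y: "\<omega> x y \<noteq> 0" using nondegenerate by blast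
    have "\<omega> x y = \<omega> (l (e i 0 0) (r x (e j 0 0))) y"
      using 5 by (simp add: corner_def)
    also have "\<dots> = \<omega> x (block_entry j 0 i 0 y)"
      by (simp only: move_left_to_right move_right_to_left block_entry_def)
    finally have "\<omega> x (block_entry j 0 i 0 y) \<noteq> 0" using y by simp
    moreover have "block_entry j 0 i 0 y \<in> corner j i"
      using 5 size_pos by (intro block_entry_corner) auto
    ultimately show ?case by blast
  qed
qed

text \<open>
  The units that lead from the entry \<open>(p, q)\<close> of \<open>x\<close> back to its position move across the form and
  cut out the entry \<open>(q, p)\<close> of \<open>y\<close>, as in the trace of a product of matrices.
\<close>

lemma form_blocks:
  "\<omega> x y = (\<Sum>i<n. \<Sum>j<n. \<Sum>p<\<alpha> i. \<Sum>q<\<alpha> j. \<omega> (block_entry i p j q x) (block_entry j q i p y))"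
  by (subst block_expansion[of x])
     (simp add: form_left.sum move_left_to_right move_right_to_left block_entry_def)

text \<open>
  Let the arrow \<open>a\<close> stand for \<open>u a\<close> and its reverse for \<open>v a\<close>. The coordinates of \<open>c\<close> along \<open>u a\<close> and
  \<open>v a\<close> are \<open>\<omega> (v a) c\<close> and \<open>- \<omega> (u a) c\<close>. Expanding the first argument of \<open>\<omega> c c'\<close> accordingly gives
  the sum over \<open>a\<close> of \<open>\<omega> (v a) c * \<omega> (u a) c' - \<omega> (u a) c * \<omega> (v a) c'\<close>, and summation over all
  blocks and entries turns the two products into the two traces of the quiver form.
\<close>

theorem equivalent_to_quiver_quadruple:
  assumes fd: "finite_dimensional_vector_space scaleM B"
    and \<zeta>: "Vector_Spaces.linear scaleA (*) \<zeta>" "\<And>a b. \<zeta> (a * b) = \<zeta> (b * a)"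
  shows "\<exists>Q :: (nat, nat) pre_digraph. fin_digraph Q \<and>
    equivalent (type_algebra scaleA, type_bimodule scaleM l r, \<omega>, \<zeta>)
      (quiver_quadruple Q \<alpha> (\<lambda>i. \<zeta> (e i 0 0)))"
proof -
  interpret graded: graded_symplectic_space scaleM B \<omega> "{..<n}" corner
    by (rule graded_corners[OF fd])
  obtain N dst src u v where darboux: "graded.homogeneous_darboux N dst src u v"
    and spanning: "\<And>i j x. i < n \<Longrightarrow> j < n \<Longrightarrow> x \<in> corner i j \<Longrightarrow> graded.darboux_part N u v x = x"
    using graded.exists_homogeneous_darboux_basis by auto
  have ends: "dst a < n" "src a < n" "u a \<in> corner (dst a) (src a)" "v a \<in> corner (src a) (dst a)"
    if "a < N" for a
    using darboux that by (auto simp: graded.homogeneous_darboux_def)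
  have pairing: "\<omega> (u a) (u b) = 0" "\<omega> (v a) (v b) = 0" "\<omega> (v a) (u b) = (if a = b then 1 else 0)"
    "\<omega> (u a) (v b) = (if a = b then - 1 else 0)" if "a < N" "b < N" for a b
    using darboux that skew[of "u a" "v b"] by (auto simp: graded.homogeneous_darboux_def)
  have u_degree: "dst a = j \<and> src a = i" if "a < N" "i < n" "j < n" "x \<in> corner i j" "\<omega> (u a) x \<noteq> 0" for a i j x
    using graded.graded[of "dst a" "src a" i j "u a" x] ends[OF that(1)] that by auto
  have v_degree: "dst a = i \<and> src a = j" if "a < N" "i < n" "j < n" "x \<in> corner i j" "\<omega> (v a) x \<noteq> 0" for a i j x
    using graded.graded[of "src a" "dst a" i j "v a" x] ends[OF that(1)] that by auto

  define Q :: "(nat, nat) pre_digraph" where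
    "Q = \<lparr>verts = {..<n}, arcs = {..<N}, tail = src, head = dst\<rparr>"
  have Q: "verts Q = {..<n}" "arcs Q = {..<N}" "arcs (double Q) = {..<N} <+> {..<N}"
    "head (double Q) = case_sum dst src" "tail (double Q) = case_sum src dst"
    by (simp_all add: Q_def double_def)
  have "fin_digraph Q"
    by unfold_locales (auto simp: Q_def ends)
  define d where "d = case_sum u v"
  define \<phi> where "\<phi> = case_sum (\<lambda>a. \<omega> (v a)) (\<lambda>a x. - \<omega> (u a) x)"
  interpret HB: homogeneous_basis scaleA scaleM l r n \<alpha> e "double Q" d \<phi>
  proof (intro homogeneous_basis.intro homogeneous_basis_axioms.intro, goal_cases)
    case 1
    show ?case by (rule bimodule_over_matrix_units_axioms)
  next
    case 2
    show ?case by (simp add: Q)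
  next
    case (3 b)
    then show ?case using ends by (auto simp: Q)
  next
    case (4 b)
    then show ?case using ends by (auto simp: Q)
  next
    case (5 b)
    then show ?case using ends by (auto simp: Q d_def)
  next
    case (6 b)
    show ?case
      by (cases b)
         (auto simp: \<phi>_def Vector_Spaces.linear_iff vs.vector_space_axioms form_right.vs2.vector_space_axioms
           form_right.add form_right.scale)
  next
    case (7 b c)
    then show ?case using pairing by (auto simp: Q d_def \<phi>_def split: if_splits)
  next
    case (8 b i j x)
    then show ?case using u_degree v_degree by (auto simp: Q \<phi>_def)
  next
    case (9 i j x)
    have "(\<Sum>b\<in>arcs (double Q). scaleM (\<phi> b x) (d b)) = graded.darboux_part N u v x"
      by (simp add: Q sum.Plus graded.darboux_part_def d_def \<phi>_def sum_subtractf sum_negf)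
    then show ?case using spanning[OF 9] by simp
  qed

  have form: "quiver_form Q (HB.to_Rep x) (HB.to_Rep y) = \<omega> x y" for x y
  proof -
    let ?x = "\<lambda>i p j q. block_entry i p j q x" and ?y = "\<lambda>i p j q. block_entry i p j q y"
    let ?A = "\<lambda>a i j. \<Sum>p<\<alpha> i. \<Sum>q<\<alpha> j. \<omega> (v a) (?x i p j q) * \<omega> (u a) (?y j q i p)"
    let ?B = "\<lambda>a i j. \<Sum>p<\<alpha> i. \<Sum>q<\<alpha> j. \<omega> (u a) (?x i p j q) * \<omega> (v a) (?y j q i p)"
    have pair: "\<omega> c c' = (\<Sum>a<N. \<omega> (v a) c * \<omega> (u a) c' - \<omega> (u a) c * \<omega> (v a) c')"
      if "i < n" "j < n" "c \<in> corner i j" for i j c c'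
    proof -
      have "\<omega> c c' = \<omega> (graded.darboux_part N u v c) c'"
        using spanning[OF that] by simp
      then show ?thesis
        by (simp add: graded.darboux_part_def form_left.sum form_left.diff form_left.scale)
    qed
    have "\<omega> x y = (\<Sum>i<n. \<Sum>j<n. \<Sum>p<\<alpha> i. \<Sum>q<\<alpha> j. \<omega> (?x i p j q) (?y j q i p))"
      by (rule form_blocks)
    also have "\<dots> = (\<Sum>i<n. \<Sum>j<n. \<Sum>p<\<alpha> i. \<Sum>q<\<alpha> j. \<Sum>a<N.
        \<omega> (v a) (?x i p j q) * \<omega> (u a) (?y j q i p) - \<omega> (u a) (?x i p j q) * \<omega> (v a) (?y j q i p))"
    proof (intro sum.cong refl, unfold lessThan_iff)
      fix i j p q assume ij: "i < n" "j < n" "p < \<alpha> i" "q < \<alpha> j"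
      show "\<omega> (?x i p j q) (?y j q i p) = (\<Sum>a<N. \<omega> (v a) (?x i p j q) * \<omega> (u a) (?y j q i p) -
          \<omega> (u a) (?x i p j q) * \<omega> (v a) (?y j q i p))"
        by (rule pair[OF ij(1,2) block_entry_corner[OF ij]])
    qed
    also have "\<dots> = (\<Sum>a<N. (\<Sum>i<n. \<Sum>j<n. ?A a i j) - (\<Sum>i<n. \<Sum>j<n. ?B a i j))"
      by (simp only: sum_swap_innermost[where A = "{..<N}"] sum_subtractf)
    \<comment> \<open>Each arrow is seen by a single block of \<open>x\<close>: its own for \<open>v a\<close>, the transposed one for \<open>u a\<close>.\<close>
    also have "\<dots> = (\<Sum>a<N. ?A a (dst a) (src a) - ?B a (src a) (dst a))"
    proof (rule sum.cong[OF refl])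
      fix a assume "a \<in> {..<N}"
      then have a: "a < N" by simp
      have "(\<Sum>i<n. \<Sum>j<n. ?A a i j) = ?A a (dst a) (src a)"
      proof (rule double_sum_single)
        fix i j assume ij: "i \<in> {..<n}" "j \<in> {..<n}" and "?A a i j \<noteq> 0"
        then obtain p where p: "p \<in> {..<\<alpha> i}"
          and "(\<Sum>q<\<alpha> j. \<omega> (v a) (?x i p j q) * \<omega> (u a) (?y j q i p)) \<noteq> 0"
          by (blast elim: sum.not_neutral_contains_not_neutral)
        then obtain q where "q \<in> {..<\<alpha> j}" "\<omega> (v a) (?x i p j q) * \<omega> (u a) (?y j q i p) \<noteq> 0"
          by (blast elim: sum.not_neutral_contains_not_neutral)
        then show "i = dst a \<and> j = src a"
          using v_degree[OF a, of i j "?x i p j q"] block_entry_corner[of i j p q x] ij p by auto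
      qed (use ends[OF a] in auto)
      moreover have "(\<Sum>i<n. \<Sum>j<n. ?B a i j) = ?B a (src a) (dst a)"
      proof (rule double_sum_single)
        fix i j assume ij: "i \<in> {..<n}" "j \<in> {..<n}" and "?B a i j \<noteq> 0"
        then obtain p where p: "p \<in> {..<\<alpha> i}"
          and "(\<Sum>q<\<alpha> j. \<omega> (u a) (?x i p j q) * \<omega> (v a) (?y j q i p)) \<noteq> 0"
          by (blast elim: sum.not_neutral_contains_not_neutral)
        then obtain q where "q \<in> {..<\<alpha> j}" "\<omega> (u a) (?x i p j q) * \<omega> (v a) (?y j q i p) \<noteq> 0"
          by (blast elim: sum.not_neutral_contains_not_neutral)
        then show "i = src a \<and> j = dst a"
          using u_degree[OF a, of i j "?x i p j q"] block_entry_corner[of i j p q x] ij p by auto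
      qed (use ends[OF a] in auto)
      ultimately show "(\<Sum>i<n. \<Sum>j<n. ?A a i j) - (\<Sum>i<n. \<Sum>j<n. ?B a i j) =
          ?A a (dst a) (src a) - ?B a (src a) (dst a)" by simp
    qed
    also have "\<dots> = quiver_form Q (HB.to_Rep x) (HB.to_Rep y)"
      unfolding quiver_form_def Q(2)
    proof (rule sum.cong[OF refl])
      fix a assume "a \<in> {..<N}"
      then have arcs: "Inl a \<in> arcs (double Q)" "Inr a \<in> arcs (double Q)" by (auto simp: Q)
      have entries: "HB.to_Rep z (Inl a) $$ (p, q) = \<omega> (v a) (block_entry (dst a) p (src a) q z)"
          "HB.to_Rep z (Inr a) $$ (q, p) = - \<omega> (u a) (block_entry (src a) q (dst a) p z)"
        if "p < \<alpha> (dst a)" "q < \<alpha> (src a)" for p q z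
        using HB.to_Rep_index[OF arcs(1), of p q z] HB.to_Rep_index[OF arcs(2), of q p z] that
        by (simp_all add: Q \<phi>_def)
      have carrier: "HB.to_Rep z (Inl a) \<in> carrier_mat (\<alpha> (dst a)) (\<alpha> (src a))"
          "HB.to_Rep z (Inr a) \<in> carrier_mat (\<alpha> (src a)) (\<alpha> (dst a))" for z
        using HB.to_Rep_carrier[OF arcs(1), of z] HB.to_Rep_carrier[OF arcs(2), of z]
        by (simp_all add: Q)
      show "?A a (dst a) (src a) - ?B a (src a) (dst a) =
          mat_trace (HB.to_Rep x (Inr a) * HB.to_Rep y (Inl a)) -
          mat_trace (HB.to_Rep x (Inl a) * HB.to_Rep y (Inr a))"
        by (simp add: mat_trace_mult[OF carrier(2,1)] mat_trace_mult[OF carrier(1,2)] entries sum_negf)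
    qed
    finally show ?thesis ..
  qed
  have "equivalent (type_algebra scaleA, type_bimodule scaleM l r, \<omega>, \<zeta>)
      (quiver_quadruple Q \<alpha> (\<lambda>i. \<zeta> (e i 0 0)))"
    unfolding equivalent_def quiver_quadruple_def prod.case Q(1)
    using to_End_iso HB.to_Rep_iso quiver_trace_to_End[OF \<zeta>] form by blast
  with \<open>fin_digraph Q\<close> show ?thesis by blast
qed

end

section \<open>Equivalence with the quadruple of a quiver\<close>

theorem lemma3p3:
  fixes scaleA :: "'k::{alg_closed_field, field_char_0} \<Rightarrow> 'a::{ring, monoid_mult} \<Rightarrow> 'a"
    and scaleM :: "'k \<Rightarrow> 'm::ab_group_add \<Rightarrow> 'm"
    and l :: "'a \<Rightarrow> 'm \<Rightarrow> 'm" and r :: "'m \<Rightarrow> 'a \<Rightarrow> 'm"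
    and \<omega> :: "'m \<Rightarrow> 'm \<Rightarrow> 'k" and \<zeta> :: "'a \<Rightarrow> 'k"
  assumes "k_algebra scaleA"
    and "\<exists>B. finite_dimensional_vector_space scaleA B"
    and "semisimple_ring TYPE('a)"
    and "k_bimodule scaleA scaleM l r"
    and "\<exists>B. finite_dimensional_vector_space scaleM B"
    and "symplectic_form scaleM \<omega>"
    and "balanced l r \<omega>"
    and "Vector_Spaces.linear scaleA (*) \<zeta>"
    and "\<forall>a b. \<zeta> (a * b) = \<zeta> (b * a)"
  shows "\<exists>(Q :: (nat, nat) pre_digraph) (\<alpha> :: nat \<Rightarrow> nat) (lam :: nat \<Rightarrow> 'k).
           fin_digraph Q \<and>
           equivalent (type_algebra scaleA, type_bimodule scaleM l r, \<omega>, \<zeta>)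
             (quiver_quadruple Q \<alpha> lam)"
proof -
  obtain BA BM where fd: "finite_dimensional_vector_space scaleA BA"
    "finite_dimensional_vector_space scaleM BM"
    using assms(2,5) by blast
  interpret A: fd_semisimple_algebra scaleA BA
    using assms(1,3) fd(1)
    by (intro fd_semisimple_algebra.intro fd_semisimple_algebra_axioms.intro)
  obtain n \<alpha> e where "matrix_units scaleA n \<alpha> e"
    using A.exists_matrix_units by blast
  then interpret symplectic_bimodule_over_matrix_units scaleA scaleM l r n \<alpha> e \<omega>
    using assms(4,6,7)
    by (intro symplectic_bimodule_over_matrix_units.intro bimodule_over_matrix_units.intro
        symplectic_bimodule_over_matrix_units_axioms.intro)
  show ?thesis
    using equivalent_to_quiver_quadruple[OF fd(2) assms(8)] assms(9) by blast
qed

end
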